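(* Suppose that $F:\mathbb{R}^d\to\mathbb{R}$ is twice continuously differentiable and bounded below, and that there exists a constant $L>0$ such that $$\nabla^2F(x)\preceq LI\qquad\text{for all }x\in\mathbb{R}^d .$$ Let $\theta,\nu>0$ and $0<\Lambda_1\le\Lambda_2$ be constants. Let $\{x_k\}$ be generated by the stochastic quasi-Newton iteration $x_{k+1}=x_k-\alpha_kH_kg_k^{S_k}$ (described in the context) from an arbitrary $x_0\in\mathbb{R}^d$, where for every $k$: (i) the sample size $|S_k|$ satisfies the exact variance inner product quasi-Newton test $$\frac{\mathbb{E}_k\left[\left((H_k\nabla F(x_k))^T(H_kg_k^i)-\|H_k\nabla F(x_k)\|^2\right)^2\right]}{|S_k|}\le\theta^2\|H_k\nabla F(x_k)\|^4;$$ (ii) the orthogonality condition $$\frac{\mathbb{E}_k\left[\left\|H_kg_k^i-\frac{(H_kg_k^i)^T(H_k\nabla F(x_k))}{\|H_k\nabla F(x_k)\|^2}H_k\nabla F(x_k)\right\|^2\right]}{|S_k|}\le\nu^2\|H_k\nabla F(x_k)\|^2$$ holds; (iii) $\Lambda_1I\preceq H_k\preceq\Lambda_2I$. Then, if the steplength is a constant $\alpha_k=\alpha>0$ with $$\alpha\le\frac{1}{(1+\theta^2+\nu^2)L\Lambda_2},$$ we have $$\lim_{k\to\infty}\mathbb{E}\left[\|\nabla F(x_k)\|^2\right]=0 .$$ Moreover, for any positive integer $T$, $$\min_{0\le k\le T-1}\mathbb{E}\left[\|\nabla F(x_k)\|^2\right]\le\frac{2}{\alpha T\Lambda_1}\,(F(x_0)-F_{\min}),$$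 where $F_{\min}$ is a lower bound on $F$ in $\mathbb{R}^d$.
   Context: Setting. $F(x)=\int f(x;z,y)\,dP(z,y)$ is the expected value of a loss over random data $(z,y)$ with distribution $P$. For a data point $(z^i,y^i)$ drawn from $P$, set $F_i(x)=f(x;z^i,y^i)$ and $g_k^i=\nabla F_i(x_k)$. The iteration is $$x_{k+1}=x_k-\alpha_kH_kg_k^{S_k},\qquad g_k^{S_k}=\frac1{|S_k|}\sum_{i\in S_k}\nabla F_i(x_k),$$ started from a deterministic $x_0$. At iteration $k$, the symmetric positive definite matrix $H_k$ and the sample size $|S_k|\geq 1$ are determined by the history before the sample $S_k$ is drawn (they may depend on the past iterates and samples but not on the draw of $S_k$). Given this history, $S_k$ indexes $|S_k|$ independent data points with distribution $P$. $\mathbb{E}_k$ denotes conditional expectation at $x_k$, i.e. given the history up to and including $x_k,H_k,|S_k|$; $\mathbb{E}$ denotes total expectation. Stochastic gradients are unbiased, $\mathbb{E}_k[g_k^i]=\nabla F(x_k)$, and have finite conditional second moments. In $\mathbb{E}_k[\cdot]$ of expressions involving $g_k^i$, $i$ is a single data point drawn from $P$ given the history. $\|\cdot\|$ is the Euclidean norm, and $A\preceq B$ means $B-A$ is positive semidefinite. If $\nabla F(x_k)=0$, the projection term (the fraction times $H_k\nabla F(x_k)$) in the orthogonality condition is read as $0$. *)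

theory Defs
  imports "HOL-Probability.Probability"
begin

section \<open>Gradients, Hessians and the Loewner order\<close>

definition grad :: "('a::real_inner \<Rightarrow> real) \<Rightarrow> 'a \<Rightarrow> 'a" where
  "grad h v = (THE D. GDERIV h v :> D)"

definition hessian :: "(real ^ 'n \<Rightarrow> real) \<Rightarrow> real ^ 'n \<Rightarrow> real ^ 'n ^ 'n" where
  "hessian h v = jacobian (grad h) (at v)"

definition twice_continuously_differentiable :: "(real ^ 'n \<Rightarrow> real) \<Rightarrow> bool" where
  "twice_continuously_differentiable h \<longleftrightarrow>
     (\<forall>v. h differentiable (at v)) \<and>
     (\<forall>v. grad h differentiable (at v)) \<and>
     continuous_on UNIV (hessian h)"

definition pos_semidef :: "real ^ 'n ^ 'n \<Rightarrow> bool" where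
  "pos_semidef A \<longleftrightarrow> transpose A = A \<and> (\<forall>v. 0 \<le> v \<bullet> (A *v v))"

definition pos_def :: "real ^ 'n ^ 'n \<Rightarrow> bool" where
  "pos_def A \<longleftrightarrow> transpose A = A \<and> (\<forall>v. v \<noteq> 0 \<longrightarrow> 0 < v \<bullet> (A *v v))"

definition loewner_le :: "real ^ 'n ^ 'n \<Rightarrow> real ^ 'n ^ 'n \<Rightarrow> bool" (infix "\<preceq>\<^sub>L" 50) where
  "A \<preceq>\<^sub>L B \<longleftrightarrow> pos_semidef (B - A)"

section \<open>The stochastic quasi-Newton iteration\<close>

definition expected_loss :: "'z measure \<Rightarrow> ('a \<Rightarrow> 'z \<Rightarrow> real) \<Rightarrow> 'a \<Rightarrow> real" where
  "expected_loss P f v = (\<integral>\<zeta>. f v \<zeta> \<partial>P)"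

definition loss_grad :: "('a::real_inner \<Rightarrow> 'z \<Rightarrow> real) \<Rightarrow> 'z \<Rightarrow> 'a \<Rightarrow> 'a" where
  "loss_grad f \<zeta> v = grad (\<lambda>u. f u \<zeta>) v"

definition batch_grad :: "('a::real_inner \<Rightarrow> 'z \<Rightarrow> real) \<Rightarrow> nat \<Rightarrow> (nat \<Rightarrow> 'z) \<Rightarrow> 'a \<Rightarrow> 'a" where
  "batch_grad f n \<zeta> v = (1 / real n) *\<^sub>R (\<Sum>i<n. loss_grad f (\<zeta> i) v)"

text \<open>
  Conditionally on the sub-\<open>\<sigma>\<close>-algebra \<open>G\<close>, the points \<open>\<xi> 0, \<dots>, \<xi> (n - 1)\<close> are independent with
  distribution \<open>P\<close>, where the number \<open>n\<close> of points is itself random but \<open>G\<close>-measurable.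
  Nothing is required of \<open>\<xi> i \<omega>\<close> for \<open>i \<ge> n \<omega>\<close>, apart from measurability.
\<close>
definition cond_iid_sample ::
  "'w measure \<Rightarrow> 'w measure \<Rightarrow> 'z measure \<Rightarrow> ('w \<Rightarrow> nat) \<Rightarrow> (nat \<Rightarrow> 'w \<Rightarrow> 'z) \<Rightarrow> bool" where
  "cond_iid_sample M G P n \<xi> \<longleftrightarrow>
     n \<in> measurable G (count_space UNIV) \<and>
     (\<forall>i. \<xi> i \<in> measurable M P) \<and>
     (\<forall>A\<in>sets G. \<forall>m B. (\<forall>i<m. B i \<in> sets P) \<longrightarrow>
        measure M {\<omega>\<in>A. n \<omega> = m \<and> (\<forall>i<m. \<xi> i \<omega> \<in> B i)} =
        measure M {\<omega>\<in>A. n \<omega> = m} * (\<Prod>i<m. measure P (B i)))"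

text \<open>
  \<open>f v \<zeta>\<close> is the loss at \<open>v\<close> for the data point \<open>\<zeta> = (z, y)\<close>. At iteration \<open>k\<close>, \<open>G k\<close> is the
  history up to and including the iterate \<open>x k\<close>, the matrix \<open>H k\<close> and the sample size \<open>N k\<close>, but
  not the sample drawn at iteration \<open>k\<close>; the latter is indexed by \<open>{..<N k}\<close> and consists of the
  points \<open>\<xi> k i\<close>. Thus \<open>\<bbbE>\<^sub>k\<close> is conditional expectation given \<open>G k\<close>. The points of
  the sample have the same conditional law and \<open>N k \<ge> 1\<close>, so \<open>\<xi> k 0\<close> serves as the
  single data point drawn from \<open>P\<close> given the history.

  Conditional expectations of nonnegative quantities are taken as \<open>nn_cond_exp\<close>, with values in
  \<open>[0, \<infinity>]\<close>. The conditional mean of the stochastic gradient is taken componentwise with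
  \<open>real_cond_exp\<close>; finite conditional second moments ensure that it is not a junk value.
\<close>
locale stochastic_quasi_newton =
  prob_space M + data: prob_space P + filtration "space M" G
  for M :: "'w measure" and P :: "('z \<times> 'y) measure" and G :: "nat \<Rightarrow> 'w measure" +
  fixes f :: "real ^ 'n \<Rightarrow> 'z \<times> 'y \<Rightarrow> real"
    and \<xi> :: "nat \<Rightarrow> nat \<Rightarrow> 'w \<Rightarrow> 'z \<times> 'y"
    and N :: "nat \<Rightarrow> 'w \<Rightarrow> nat"
    and H :: "nat \<Rightarrow> 'w \<Rightarrow> real ^ 'n ^ 'n"
    and \<alpha> :: "nat \<Rightarrow> real"
    and x0 :: "real ^ 'n"
    and x :: "nat \<Rightarrow> 'w \<Rightarrow> real ^ 'n"
  assumes loss_integrable: "\<And>v. integrable P (f v)"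
    and loss_differentiable:
      "\<And>v \<zeta>. \<zeta> \<in> space P \<Longrightarrow> (\<lambda>u. f u \<zeta>) differentiable (at v)"
    and history_subalgebra: "\<And>k. subalgebra M (G k)"
    and past_samples_in_history:
      "\<And>k i B. B \<in> sets P \<Longrightarrow> {\<omega>\<in>space M. i < N k \<omega> \<and> \<xi> k i \<omega> \<in> B} \<in> sets (G (Suc k))"
    and iterate_in_history: "\<And>k. x k \<in> borel_measurable (G k)"
    and matrix_in_history: "\<And>k. H k \<in> borel_measurable (G k)"
    and sample_size_ge_1: "\<And>k \<omega>. \<omega> \<in> space M \<Longrightarrow> 1 \<le> N k \<omega>"
    and sample_iid: "\<And>k. cond_iid_sample M (G k) P (N k) (\<xi> k)"
    and matrix_pos_def: "\<And>k \<omega>. \<omega> \<in> space M \<Longrightarrow> pos_def (H k \<omega>)"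
    and initial: "\<And>\<omega>. \<omega> \<in> space M \<Longrightarrow> x 0 \<omega> = x0"
    and step: "\<And>k \<omega>. \<omega> \<in> space M \<Longrightarrow>
      x (Suc k) \<omega> =
        x k \<omega> - \<alpha> k *\<^sub>R (H k \<omega> *v batch_grad f (N k \<omega>) (\<lambda>i. \<xi> k i \<omega>) (x k \<omega>))"
    and finite_second_moment: "\<And>k. AE \<omega> in M.
      nn_cond_exp M (G k) (\<lambda>\<omega>. ennreal ((norm (loss_grad f (\<xi> k 0 \<omega>) (x k \<omega>)))\<^sup>2)) \<omega> < \<infinity>"
    and unbiased: "\<And>k. AE \<omega> in M. \<forall>j.
      real_cond_exp M (G k) (\<lambda>\<omega>. loss_grad f (\<xi> k 0 \<omega>) (x k \<omega>) $ j) \<omega> =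
        grad (expected_loss P f) (x k \<omega>) $ j"

section \<open>The sample size conditions\<close>

text \<open>
  \<open>n\<close> is the sample size, \<open>p\<close> stands for \<open>H\<^sub>k \<nabla>F(x\<^sub>k)\<close> and \<open>q\<close> for \<open>H\<^sub>k g\<^sub>k\<^sup>i\<close>.
\<close>
definition inner_product_qn_test ::
  "'w measure \<Rightarrow> 'w measure \<Rightarrow> real \<Rightarrow> ('w \<Rightarrow> nat) \<Rightarrow>
   ('w \<Rightarrow> 'a::real_inner) \<Rightarrow> ('w \<Rightarrow> 'a) \<Rightarrow> bool" where
  "inner_product_qn_test M G \<theta> n p q \<longleftrightarrow>
     (AE \<omega> in M.
        nn_cond_exp M G (\<lambda>\<omega>. ennreal ((p \<omega> \<bullet> q \<omega> - (norm (p \<omega>))\<^sup>2)\<^sup>2)) \<omega> / of_nat (n \<omega>)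
        \<le> ennreal (\<theta>\<^sup>2 * norm (p \<omega>) ^ 4))"

text \<open>If \<open>p \<omega> = 0\<close>, the projection term is \<open>0\<close>, as division by zero yields zero.\<close>
definition orthogonality_condition ::
  "'w measure \<Rightarrow> 'w measure \<Rightarrow> real \<Rightarrow> ('w \<Rightarrow> nat) \<Rightarrow>
   ('w \<Rightarrow> 'a::real_inner) \<Rightarrow> ('w \<Rightarrow> 'a) \<Rightarrow> bool" where
  "orthogonality_condition M G \<nu> n p q \<longleftrightarrow>
     (AE \<omega> in M.
        nn_cond_exp M G
          (\<lambda>\<omega>. ennreal ((norm (q \<omega> - ((q \<omega> \<bullet> p \<omega>) / (norm (p \<omega>))\<^sup>2) *\<^sub>R p \<omega>))\<^sup>2)) \<omega> / of_nat (n \<omega>)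
        \<le> ennreal (\<nu>\<^sup>2 * (norm (p \<omega>))\<^sup>2))"

end

theory Submission
  imports Defs
begin

text \<open>
  The algorithm decreases the objective in expectation. Fix a lower bound \<open>Fm\<close> of \<open>F\<close> and let
  \<open>D k\<close> be the expectation of \<open>F (x k) - Fm\<close>. Everything follows from the recursion
  \<open>D (Suc k) + (a * \<Lambda>1 / 2) * e k \<le> D k\<close>, where \<open>e k\<close> is the expected squared gradient norm at
  \<open>x k\<close> (\<open>expected_objective_decrease\<close>). It telescopes to \<open>(a * \<Lambda>1 / 2) * (\<Sum>k<T. e k) \<le> F x0 - Fm\<close>
  because \<open>x0\<close> is deterministic and \<open>D T \<ge> 0\<close>. The series thus converges, its terms tend to \<open>0\<close>, and the
  smallest of the first \<open>T\<close> terms is at most their average.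

  The recursion is first proved with the history held fixed (\<open>expected_descent\<close>). By the upper bound on
  the Hessian, \<open>F\<close> lies below its quadratic Taylor model with curvature \<open>L\<close> (\<open>descent_lemma\<close>), so the
  mean and the second moment of \<open>H\<close> applied to the batch gradient suffice. The mean is
  \<open>p = H *v grad F (x k)\<close>. The variance of a mean of independent vectors is that of one vector, divided by
  the sample size (\<open>sample_mean_second_moment\<close>), and the variance of one vector splits into the part along
  \<open>p\<close>, which the inner product test bounds, and the part orthogonal to \<open>p\<close>, which the orthogonality condition
  bounds (\<open>norm_diff_square_split\<close>). Finally \<open>(norm p)\<^sup>2 \<le> \<Lambda>2 * (grad F (x k) \<bullet> p)\<close>, by
  \<open>norm_matrix_vector_square_le\<close>.

  The passage between fixed histories and actual expectations is Tonelli's theorem for the joint law of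
  the history and a conditionally independent sample (\<open>nn_integral_cond_iid_sample\<close>,
  \<open>nn_cond_exp_cond_iid_sample\<close>). It requires the sample gradient to be jointly measurable in the iterate and
  the data point (\<open>borel_measurable_grad\<close>).
\<close>

section \<open>The descent lemma and bounded quadratic forms\<close>

text \<open>
  The gradient is the Riesz representative of the derivative, here the value at \<open>1\<close> of the adjoint;
  it is unique because the derivative is.
\<close>
lemma GDERIV_grad:
  fixes h :: "'a::euclidean_space \<Rightarrow> real"
  assumes "h differentiable (at v)"
  shows "GDERIV h v :> grad h v"
proof -
  obtain h' where h': "(h has_derivative h') (at v)"
    using assms unfolding differentiable_def by blast
  define D where "D = adjoint h' 1"
  have lin: "linear h'" using h' by (rule has_derivative_linear)
  have "h' u = u \<bullet> D" for u
    using adjoint_works[OF lin, of u 1] by (simp add: D_def)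
  then have "h' = (\<lambda>u. u \<bullet> D)" by blast
  then have D: "GDERIV h v :> D"
    using h' by (simp add: gderiv_def)
  moreover have "D' = D" if "GDERIV h v :> D'" for D'
  proof -
    have "(\<lambda>u. u \<bullet> D') = (\<lambda>u. u \<bullet> D)"
      using that D unfolding gderiv_def by (rule has_derivative_unique)
    then show ?thesis
      by (subst vector_eq_rdot[symmetric]) (metis inner_commute)
  qed
  ultimately show ?thesis
    unfolding grad_def by (rule theI)
qed

text \<open>
  Along the segment from \<open>v\<close> to \<open>v + d\<close>, Taylor's formula with Lagrange remainder leaves \<open>d \<bullet> (hessian F u *v d) / 2\<close> at one intermediate point \<open>u\<close>.
\<close>
lemma descent_lemma:
  fixes F :: "real ^ 'n \<Rightarrow> real"
  assumes C2: "twice_continuously_differentiable F"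
    and hessian_le: "\<And>v. hessian F v \<preceq>\<^sub>L L *\<^sub>R mat 1"
  shows "F (v + d) \<le> F v + grad F v \<bullet> d + L / 2 * (norm d)\<^sup>2"
proof -
  have line: "((\<lambda>t. v + t *\<^sub>R d) has_derivative (\<lambda>h. h *\<^sub>R d)) (at t)" for t
    by (auto intro!: derivative_eq_intros)
  have 1: "((\<lambda>t. F (v + t *\<^sub>R d)) has_real_derivative grad F (v + t *\<^sub>R d) \<bullet> d) (at t)" for t
  proof -
    have "(F has_derivative (\<lambda>h. h \<bullet> grad F (v + t *\<^sub>R d))) (at (v + t *\<^sub>R d))"
      using GDERIV_grad[of F "v + t *\<^sub>R d"] C2
      by (simp add: gderiv_def twice_continuously_differentiable_def)
    from has_derivative_compose[OF line this]
    show ?thesis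
      by (simp add: has_field_derivative_def inner_commute mult_commute_abs)
  qed
  have 2: "((\<lambda>t. grad F (v + t *\<^sub>R d) \<bullet> d) has_real_derivative
      d \<bullet> (hessian F (v + t *\<^sub>R d) *v d)) (at t)" for t
  proof -
    have "(grad F has_derivative (\<lambda>h. hessian F (v + t *\<^sub>R d) *v h)) (at (v + t *\<^sub>R d))"
      using C2 by (simp add: hessian_def jacobian_works[symmetric] twice_continuously_differentiable_def)
    from has_derivative_inner_left[OF has_derivative_compose[OF line this], of d]
    show ?thesis
      by (simp add: has_field_derivative_def matrix_vector_mult_scaleR inner_commute mult_commute_abs)
  qed
  define diff where "diff m t = (if m = 0 then F (v + t *\<^sub>R d)
     else if m = 1 then grad F (v + t *\<^sub>R d) \<bullet> d else d \<bullet> (hessian F (v + t *\<^sub>R d) *v d))" for m :: nat and t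
  have "\<exists>t. 0 < t \<and> t \<le> 1 \<and>
      F (v + 1 *\<^sub>R d) = (\<Sum>m<2. diff m 0 / fact m * 1 ^ m) + diff 2 t / fact 2 * 1 ^ 2"
    by (rule Maclaurin2) (auto simp: diff_def less_2_cases_iff 1 2)
  then obtain t where "F (v + d) = F v + grad F v \<bullet> d + d \<bullet> (hessian F (v + t *\<^sub>R d) *v d) / 2"
    by (auto simp: diff_def numeral_2_eq_2)
  moreover have "d \<bullet> (hessian F (v + t *\<^sub>R d) *v d) \<le> L * (norm d)\<^sup>2"
    using hessian_le[of "v + t *\<^sub>R d"]
    by (auto simp: loewner_le_def pos_semidef_def matrix_vector_mult_diff_rdistrib inner_diff_right
        scaleR_matrix_vector_assoc[symmetric] power2_norm_eq_inner)
  ultimately show ?thesis by simp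
qed

text \<open>
  The matrix form of \<open>\<lambda>\<^sup>2 \<le> c \<lambda>\<close> for eigenvalues \<open>0 \<le> \<lambda> \<le> c\<close>. Instead of
  diagonalizing, evaluate the quadratic form of \<open>A\<close> at \<open>v - (1 / c) *\<^sub>R (A *v v)\<close>, where it is
  nonnegative. With \<open>c = \<Lambda>2\<close>, this is where \<open>\<Lambda>2\<close> enters the steplength bound, and to the first power only.
\<close>
lemma norm_matrix_vector_square_le:
  fixes A :: "real ^ 'n ^ 'n"
  assumes sym: "transpose A = A" and psd: "\<And>v. 0 \<le> v \<bullet> (A *v v)"
    and le: "A \<preceq>\<^sub>L c *\<^sub>R mat 1" and c: "0 < c"
  shows "(norm (A *v v))\<^sup>2 \<le> c * (v \<bullet> (A *v v))"
proof -
  define w where "w = A *v v"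
  have swap: "u \<bullet> (A *v v) = (A *v u) \<bullet> v" for u v
    using dot_lmul_matrix[of u A v] sym by (metis transpose_matrix_vector)
  have "0 \<le> (v - (1 / c) *\<^sub>R w) \<bullet> (A *v (v - (1 / c) *\<^sub>R w))" by (rule psd)
  also have "\<dots> = v \<bullet> w - 2 / c * (w \<bullet> w) + (w \<bullet> (A *v w)) / c\<^sup>2"
    using swap[of v w] by (simp add: matrix_vector_mult_diff_distrib matrix_vector_mult_scaleR inner_diff_left
        inner_diff_right w_def[symmetric] power2_eq_square diff_divide_distrib)
  also have "w \<bullet> (A *v w) \<le> c * (w \<bullet> w)"
    using le by (auto simp: loewner_le_def pos_semidef_def matrix_vector_mult_diff_rdistrib inner_diff_right
        scaleR_matrix_vector_assoc[symmetric])
  finally have "0 \<le> v \<bullet> w - 2 / c * (w \<bullet> w) + (c * (w \<bullet> w)) / c\<^sup>2"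
    using c by (simp add: divide_right_mono)
  then show ?thesis using c
    unfolding w_def[symmetric] power2_norm_eq_inner
    by (simp add: field_simps power2_eq_square)
qed

section \<open>Measurability of gradients\<close>

text \<open>
  Replace \<open>v\<close> by the first point of a countable dense sequence that lies within \<open>1 / (k + 1)\<close> of it.
  The resulting functions are measurable because each is glued from countably many sections of \<open>f\<close>,
  and they converge to \<open>f\<close> by continuity.
\<close>
lemma borel_measurable_caratheodory:
  fixes f :: "'a::{metric_space, second_countable_topology} \<Rightarrow> 'z \<Rightarrow> 'b::metric_space"
  assumes meas[measurable]: "\<And>v. f v \<in> borel_measurable P"
    and cont: "\<And>\<zeta>. \<zeta> \<in> space P \<Longrightarrow> continuous_on UNIV (\<lambda>v. f v \<zeta>)"
  shows "(\<lambda>(v, \<zeta>). f v \<zeta>) \<in> borel_measurable (borel \<Otimes>\<^sub>M P)"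
proof -
  obtain D :: "'a set" where D: "countable D" "\<And>X. open X \<Longrightarrow> X \<noteq> {} \<Longrightarrow> \<exists>d\<in>D. d \<in> X"
    using countable_dense_exists by blast
  define d where "d = from_nat_into D"
  have near: "\<exists>i. dist (d i) v < e" if e: "0 < e" for v e
  proof -
    obtain w where "w \<in> D" "w \<in> ball v e"
      using D(2)[OF open_ball, of v e] e by auto
    then show ?thesis
      using from_nat_into_surj[OF D(1)] by (metis d_def dist_commute mem_ball)
  qed
  define idx where "idx k v = (LEAST i. dist (d i) v < 1 / real (Suc k))" for k v
  have idx: "dist (d (idx k v)) v < 1 / real (Suc k)" for k v
    unfolding idx_def by (rule LeastI_ex) (simp add: near)
  have [measurable]: "idx k \<in> measurable borel (count_space UNIV)" for k
    unfolding idx_def by measurable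
  have "(\<lambda>p. f (d (idx k (fst p))) (snd p)) \<in> borel_measurable (borel \<Otimes>\<^sub>M P)" for k
    by (rule measurable_compose_countable[where f = "\<lambda>i p. f (d i) (snd p)" and g = "\<lambda>p. idx k (fst p)"])
      measurable
  moreover have "(\<lambda>k. f (d (idx k (fst p))) (snd p)) \<longlonglongrightarrow> f (fst p) (snd p)"
    if "p \<in> space (borel \<Otimes>\<^sub>M P)" for p
  proof -
    have "(\<lambda>k. d (idx k (fst p))) \<longlonglongrightarrow> fst p"
    proof (rule tendsto_dist_iff[THEN iffD2], rule tendsto_sandwich[OF _ _ tendsto_const])
      show "(\<lambda>k. 1 / real (Suc k)) \<longlonglongrightarrow> 0" by real_asymp
      show "\<forall>\<^sub>F k in sequentially. dist (d (idx k (fst p))) (fst p) \<le> 1 / real (Suc k)"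
        by (intro always_eventually allI less_imp_le idx)
    qed simp
    moreover have "isCont (\<lambda>v. f v (snd p)) (fst p)"
      using cont[of "snd p"] that by (simp add: space_pair_measure continuous_on_eq_continuous_at mem_Times_iff)
    ultimately show ?thesis
      by (intro isCont_tendsto_compose[where g = "\<lambda>v. f v (snd p)"])
  qed
  ultimately have "(\<lambda>p. f (fst p) (snd p)) \<in> borel_measurable (borel \<Otimes>\<^sub>M P)"
    by (rule borel_measurable_LIMSEQ_metric)
  then show ?thesis by (simp add: case_prod_beta')
qed

text \<open>
  The components of the gradient are pointwise limits of difference quotients of a Caratheodory
  function. Joint measurability matters because the gradient is evaluated at a random iterate.
\<close>
lemma borel_measurable_grad:
  fixes f :: "'a::euclidean_space \<Rightarrow> 'z \<Rightarrow> real"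
  assumes meas: "\<And>v. f v \<in> borel_measurable P"
    and diff: "\<And>v \<zeta>. \<zeta> \<in> space P \<Longrightarrow> (\<lambda>u. f u \<zeta>) differentiable (at v)"
  shows "(\<lambda>(v, \<zeta>). grad (\<lambda>u. f u \<zeta>) v) \<in> borel_measurable (borel \<Otimes>\<^sub>M P)"
proof (subst borel_measurable_euclidean_space, rule ballI)
  fix b :: 'a
  have "(\<lambda>(v, \<zeta>). f v \<zeta>) \<in> borel_measurable (borel \<Otimes>\<^sub>M P)"
    using diff by (intro borel_measurable_caratheodory meas differentiable_imp_continuous_on)
      (auto simp: differentiable_on_def)
  then have [measurable]: "(\<lambda>p. f (g p) (snd p)) \<in> borel_measurable (borel \<Otimes>\<^sub>M P)"
    if "g \<in> borel_measurable (borel \<Otimes>\<^sub>M P)" for g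
    using measurable_compose[OF measurable_Pair[OF that measurable_snd] \<open>(\<lambda>(v, \<zeta>). f v \<zeta>) \<in> _\<close>]
    by simp
  have "(\<lambda>p. (f (fst p + (1 / real (Suc k)) *\<^sub>R b) (snd p) - f (fst p) (snd p)) / (1 / real (Suc k)))
      \<in> borel_measurable (borel \<Otimes>\<^sub>M P)" for k
    by measurable
  moreover have "(\<lambda>k. (f (fst p + (1 / real (Suc k)) *\<^sub>R b) (snd p) - f (fst p) (snd p)) / (1 / real (Suc k)))
      \<longlonglongrightarrow> grad (\<lambda>u. f u (snd p)) (fst p) \<bullet> b" if p: "p \<in> space (borel \<Otimes>\<^sub>M P)" for p
  proof -
    let ?h = "\<lambda>u. f u (snd p)" and ?v = "fst p"
    have "GDERIV ?h ?v :> grad ?h ?v"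
      using diff p by (intro GDERIV_grad) (auto simp: space_pair_measure)
    then have "(?h has_derivative (\<lambda>u. u \<bullet> grad ?h ?v)) (at (?v + 0 *\<^sub>R b))"
      by (simp add: gderiv_def)
    moreover have "((\<lambda>t. ?v + t *\<^sub>R b) has_derivative (\<lambda>t. t *\<^sub>R b)) (at 0)"
      by (auto intro!: derivative_eq_intros)
    ultimately have "((\<lambda>t. ?h (?v + t *\<^sub>R b)) has_real_derivative grad ?h ?v \<bullet> b) (at 0)"
      using has_derivative_compose by (fastforce simp: has_field_derivative_def inner_commute mult_commute_abs)
    then have "((\<lambda>t. (?h (?v + t *\<^sub>R b) - ?h ?v) / t) \<longlongrightarrow> grad ?h ?v \<bullet> b) (at 0)"
      by (simp add: DERIV_def)
    moreover have "filterlim (\<lambda>k. 1 / real (Suc k)) (at 0) sequentially" by real_asymp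
    ultimately show ?thesis by (rule filterlim_compose)
  qed
  ultimately have "(\<lambda>p. grad (\<lambda>u. f u (snd p)) (fst p) \<bullet> b) \<in> borel_measurable (borel \<Otimes>\<^sub>M P)"
    by (rule borel_measurable_LIMSEQ_metric)
  then show "(\<lambda>x. (case x of (v, \<zeta>) \<Rightarrow> grad (\<lambda>u. f u \<zeta>) v) \<bullet> b) \<in> borel_measurable (borel \<Otimes>\<^sub>M P)"
    by (simp add: case_prod_beta')
qed

lemma borel_measurable_matrix_vector_mult[measurable (raw)]:
  fixes A :: "'w \<Rightarrow> real ^ 'n ^ 'm"
  assumes "A \<in> borel_measurable M" "v \<in> borel_measurable M"
  shows "(\<lambda>\<omega>. A \<omega> *v v \<omega>) \<in> borel_measurable M"
  using assms
  by (rule borel_measurable_continuous_Pair) (simp add: matrix_vector_mult_def, intro continuous_intros)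

section \<open>Integrating out a conditionally independent sample\<close>

text \<open>
  The definition of conditional independence speaks about boxes. Given an event \<open>A\<close> of the history with
  \<open>n = m\<close>, the law of the sample under the measure conditioned on that event agrees with the product
  measure on boxes, hence everywhere. The event may be null, and is then treated separately.
\<close>
lemma emeasure_cond_iid_sample:
  assumes "prob_space M" "prob_space P" and sub: "subalgebra M G"
    and iid: "cond_iid_sample M G P n \<xi>"
    and A: "A \<in> sets G" and B: "B \<in> sets (PiM {..<m} (\<lambda>_. P))"
  shows "emeasure M {\<omega>\<in>A. n \<omega> = m \<and> (\<lambda>i\<in>{..<m}. \<xi> i \<omega>) \<in> B} =
    emeasure M {\<omega>\<in>A. n \<omega> = m} * emeasure (PiM {..<m} (\<lambda>_. P)) B"
proof -
  interpret M: prob_space M by fact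
  interpret P: prob_space P by fact
  interpret prod: product_sigma_finite "\<lambda>_::nat. P" ..
  define A' where "A' = {\<omega>\<in>A. n \<omega> = m}"
  have n[measurable]: "n \<in> measurable G (count_space UNIV)"
    and \<xi>[measurable]: "\<And>i. \<xi> i \<in> measurable M P"
    using iid by (auto simp: cond_iid_sample_def)
  have "A' = A \<inter> (n -` {m} \<inter> space G)"
    using sets.sets_into_space[OF A] by (auto simp: A'_def)
  then have "A' \<in> sets G" using measurable_sets[OF n, of "{m}"] A by auto
  then have A'[measurable]: "A' \<in> sets M" and A'_sub: "A' \<subseteq> space M"
    using sub sets.sets_into_space[of A' G] by (auto simp: subalgebra_def)
  have joint[measurable]: "(\<lambda>\<omega>. \<lambda>i\<in>{..<m}. \<xi> i \<omega>) \<in> measurable M (PiM {..<m} (\<lambda>_. P))"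
    by measurable
  show ?thesis
  proof (cases "emeasure M A' = 0")
    case True
    have "emeasure M {\<omega>\<in>A. n \<omega> = m \<and> (\<lambda>i\<in>{..<m}. \<xi> i \<omega>) \<in> B} \<le> emeasure M A'"
      by (rule emeasure_mono) (auto simp: A'_def A'[unfolded A'_def])
    then show ?thesis using True by (simp add: A'_def)
  next
    case False
    define U where "U = uniform_measure M A'"
    have fin: "emeasure M A' \<noteq> \<infinity>" by simp
    have U: "emeasure U X = emeasure M (A' \<inter> X) / emeasure M A'" if "X \<in> sets M" for X
      using that by (simp add: U_def)
    have D: "distr U (PiM {..<m} (\<lambda>_. P)) (\<lambda>\<omega>. \<lambda>i\<in>{..<m}. \<xi> i \<omega>) = PiM {..<m} (\<lambda>_. P)"
    proof (rule prod.PiM_eqI)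
      fix C assume C: "\<And>i. i \<in> {..<m} \<Longrightarrow> C i \<in> sets P"
      then have PC[measurable]: "Pi\<^sub>E {..<m} C \<in> sets (PiM {..<m} (\<lambda>_. P))" by simp
      have "emeasure (distr U (PiM {..<m} (\<lambda>_. P)) (\<lambda>\<omega>. \<lambda>i\<in>{..<m}. \<xi> i \<omega>)) (Pi\<^sub>E {..<m} C)
        = emeasure U ((\<lambda>\<omega>. \<lambda>i\<in>{..<m}. \<xi> i \<omega>) -` (Pi\<^sub>E {..<m} C) \<inter> space M)"
        using PC by (subst emeasure_distr) (auto simp: U_def)
      also have "\<dots> = emeasure M (A' \<inter> ((\<lambda>\<omega>. \<lambda>i\<in>{..<m}. \<xi> i \<omega>) -` (Pi\<^sub>E {..<m} C) \<inter> space M)) / emeasure M A'"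
        by (intro U measurable_sets[OF joint PC])
      also have "A' \<inter> ((\<lambda>\<omega>. \<lambda>i\<in>{..<m}. \<xi> i \<omega>) -` (Pi\<^sub>E {..<m} C) \<inter> space M)
          = {\<omega>\<in>A. n \<omega> = m \<and> (\<forall>i<m. \<xi> i \<omega> \<in> C i)}"
        using A'_sub by (auto simp: A'_def PiE_iff)
      also have "emeasure M \<dots> = emeasure M A' * (\<Prod>i<m. emeasure P (C i))"
        using iid A C unfolding M.emeasure_eq_measure P.emeasure_eq_measure A'_def cond_iid_sample_def
        by (simp add: ennreal_mult prod_ennreal prod_nonneg)
      also have "\<dots> / emeasure M A' = (\<Prod>i<m. emeasure P (C i))"
        using False fin by (subst mult.commute, intro mult_divide_eq_ennreal) auto
      finally show "emeasure (distr U (PiM {..<m} (\<lambda>_. P)) (\<lambda>\<omega>. \<lambda>i\<in>{..<m}. \<xi> i \<omega>)) (Pi\<^sub>E {..<m} C)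
        = (\<Prod>i\<in>{..<m}. emeasure P (C i))" .
    qed auto
    have "emeasure (PiM {..<m} (\<lambda>_. P)) B
        = emeasure (distr U (PiM {..<m} (\<lambda>_. P)) (\<lambda>\<omega>. \<lambda>i\<in>{..<m}. \<xi> i \<omega>)) B"
      by (simp only: D)
    also have "\<dots> = emeasure U ((\<lambda>\<omega>. \<lambda>i\<in>{..<m}. \<xi> i \<omega>) -` B \<inter> space M)"
      using B by (subst emeasure_distr) (auto simp: U_def)
    also have "\<dots> = emeasure M (A' \<inter> ((\<lambda>\<omega>. \<lambda>i\<in>{..<m}. \<xi> i \<omega>) -` B \<inter> space M)) / emeasure M A'"
      by (intro U measurable_sets[OF joint B])
    also have "A' \<inter> ((\<lambda>\<omega>. \<lambda>i\<in>{..<m}. \<xi> i \<omega>) -` B \<inter> space M)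
        = {\<omega>\<in>A. n \<omega> = m \<and> (\<lambda>i\<in>{..<m}. \<xi> i \<omega>) \<in> B}"
      using A'_sub by (auto simp: A'_def)
    finally show ?thesis
      using False fin unfolding A'_def[symmetric]
      by (simp add: ennreal_times_divide, subst mult.commute, subst mult_divide_eq_ennreal) auto
  qed
qed

text \<open>
  On \<open>{n = m}\<close> the joint law of history and sample is a product measure: the preceding lemma says so on
  rectangles. Tonelli's theorem for that product is then the claim.
\<close>
lemma nn_integral_cond_iid_sample_fixed_size:
  assumes "prob_space M" "prob_space P" and sub: "subalgebra M G"
    and iid: "cond_iid_sample M G P n \<xi>"
    and \<phi>[measurable]: "\<phi> \<in> borel_measurable (G \<Otimes>\<^sub>M PiM {..<m} (\<lambda>_. P))"
  shows "(\<integral>\<^sup>+\<omega>. \<phi> (\<omega>, \<lambda>i\<in>{..<m}. \<xi> i \<omega>) * indicator {\<omega>\<in>space M. n \<omega> = m} \<omega> \<partial>M) =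
    (\<integral>\<^sup>+\<omega>. (\<integral>\<^sup>+s. \<phi> (\<omega>, s) \<partial>PiM {..<m} (\<lambda>_. P)) * indicator {\<omega>\<in>space M. n \<omega> = m} \<omega> \<partial>M)"
proof -
  interpret M: prob_space M by fact
  interpret P: prob_space P by fact
  interpret Q: prob_space "PiM {..<m} (\<lambda>_. P)" by (rule prob_space_PiM) (rule assms)
  have spG: "space G = space M" using sub by (simp add: subalgebra_def)
  have n[measurable]: "n \<in> measurable G (count_space UNIV)"
    and \<xi>[measurable]: "\<And>i. \<xi> i \<in> measurable M P"
    using iid by (auto simp: cond_iid_sample_def)
  let ?E = "{\<omega>\<in>space M. n \<omega> = m}"
  have E_G[measurable]: "?E \<in> sets G" unfolding spG[symmetric] by measurable
  have E_M[measurable]: "?E \<in> sets M" using E_G sub by (auto simp: subalgebra_def)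
  have id: "(\<lambda>\<omega>. \<omega>) \<in> measurable M G" using sub by (rule measurable_from_subalg) simp
  have joint[measurable]: "(\<lambda>\<omega>. (\<omega>, \<lambda>i\<in>{..<m}. \<xi> i \<omega>)) \<in> measurable M (G \<Otimes>\<^sub>M PiM {..<m} (\<lambda>_. P))"
    by (intro measurable_Pair id) measurable
  have inner: "(\<lambda>\<omega>. \<integral>\<^sup>+s. \<phi> (\<omega>, s) \<partial>PiM {..<m} (\<lambda>_. P)) \<in> borel_measurable G"
    using Q.borel_measurable_nn_integral_fst[OF \<phi>] by simp
  let ?R = "restr_to_subalg M G"
  define R where "R = density ?R (indicator ?E)"
  define S where "S = distr (density M (indicator ?E)) (G \<Otimes>\<^sub>M PiM {..<m} (\<lambda>_. P)) (\<lambda>\<omega>. (\<omega>, \<lambda>i\<in>{..<m}. \<xi> i \<omega>))"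
  have setsR: "sets R = sets G" using sub by (simp add: R_def sets_restr_to_subalg)
  have R: "emeasure R A = emeasure M {\<omega>\<in>A. n \<omega> = m}" if A: "A \<in> sets G" for A
  proof -
    have *: "?E \<inter> A = {\<omega>\<in>A. n \<omega> = m}" using sets.sets_into_space[OF A] spG by auto
    have "emeasure R A = emeasure ?R (?E \<inter> A)"
      unfolding R_def by (rule emeasure_restricted; unfold sets_restr_to_subalg[OF sub]) (fact E_G A)+
    also have "\<dots> = emeasure M (?E \<inter> A)"
      by (intro emeasure_restr_to_subalg[OF sub] sets.Int E_G A)
    finally show ?thesis by (simp add: *)
  qed
  have finR: "finite_measure R"
    by (rule finite_measureI) (use R[of "space G"] sets_eq_imp_space_eq[OF setsR] in \<open>simp\<close>)
  have RS: "R \<Otimes>\<^sub>M PiM {..<m} (\<lambda>_. P) = S"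
  proof (rule pair_measure_eqI)
    show "sigma_finite_measure R" using finR by (rule finite_measure.axioms)
    show "sigma_finite_measure (PiM {..<m} (\<lambda>_. P))" ..
    show "sets (R \<Otimes>\<^sub>M PiM {..<m} (\<lambda>_. P)) = sets S"
      unfolding S_def sets_distr by (intro sets_pair_measure_cong setsR refl)
    fix A B assume A: "A \<in> sets R" and B: "B \<in> sets (PiM {..<m} (\<lambda>_. P))"
    have "emeasure S (A \<times> B) = emeasure M (?E \<inter> ((\<lambda>\<omega>. (\<omega>, \<lambda>i\<in>{..<m}. \<xi> i \<omega>)) -` (A \<times> B) \<inter> space M))"
      using A B setsR unfolding S_def
      by (subst emeasure_distr) (simp_all add: emeasure_restricted measurable_sets[OF joint] space_density)
    also have "?E \<inter> ((\<lambda>\<omega>. (\<omega>, \<lambda>i\<in>{..<m}. \<xi> i \<omega>)) -` (A \<times> B) \<inter> space M)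
       = {\<omega>\<in>A. n \<omega> = m \<and> (\<lambda>i\<in>{..<m}. \<xi> i \<omega>) \<in> B}"
      using sets.sets_into_space[of A G] A setsR spG by auto
    finally show "emeasure R A * emeasure (PiM {..<m} (\<lambda>_. P)) B = emeasure S (A \<times> B)"
      using emeasure_cond_iid_sample[OF assms(1-4) _ B] A setsR R by simp
  qed
  have "(\<integral>\<^sup>+\<omega>. \<phi> (\<omega>, \<lambda>i\<in>{..<m}. \<xi> i \<omega>) * indicator ?E \<omega> \<partial>M) = (\<integral>\<^sup>+p. \<phi> p \<partial>S)"
    unfolding S_def by (subst nn_integral_distr) (auto simp: nn_integral_density mult.commute)
  also have "\<dots> = (\<integral>\<^sup>+\<omega>. (\<integral>\<^sup>+s. \<phi> (\<omega>, s) \<partial>PiM {..<m} (\<lambda>_. P)) \<partial>R)"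
    unfolding RS[symmetric]
    by (rule Q.nn_integral_fst[symmetric]) (use \<phi> setsR in \<open>simp cong: measurable_cong_sets sets_pair_measure_cong\<close>)
  also have "\<dots> = (\<integral>\<^sup>+\<omega>. (\<integral>\<^sup>+s. \<phi> (\<omega>, s) \<partial>PiM {..<m} (\<lambda>_. P)) * indicator ?E \<omega> \<partial>?R)"
    unfolding R_def
    by (subst nn_integral_density;
        (intro measurable_in_subalg[OF sub] inner borel_measurable_indicator E_G)?; simp add: mult.commute)
  also have "\<dots> = (\<integral>\<^sup>+\<omega>. (\<integral>\<^sup>+s. \<phi> (\<omega>, s) \<partial>PiM {..<m} (\<lambda>_. P)) * indicator ?E \<omega> \<partial>M)"
    by (intro nn_integral_subalgebra2[OF sub] borel_measurable_times_ennreal inner borel_measurable_indicator E_G)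
  finally show ?thesis .
qed

lemma nn_integral_split_nat:
  fixes n :: "'w \<Rightarrow> nat"
  assumes [measurable]: "n \<in> measurable M (count_space UNIV)" "\<psi> \<in> borel_measurable M"
  shows "(\<integral>\<^sup>+\<omega>. \<psi> \<omega> \<partial>M) = (\<Sum>m. \<integral>\<^sup>+\<omega>. \<psi> \<omega> * indicator {\<omega>\<in>space M. n \<omega> = m} \<omega> \<partial>M)"
proof -
  have "(\<integral>\<^sup>+\<omega>. \<psi> \<omega> \<partial>M) = (\<integral>\<^sup>+\<omega>. (\<Sum>m. \<psi> \<omega> * indicator {\<omega>\<in>space M. n \<omega> = m} \<omega>) \<partial>M)"
  proof (rule nn_integral_cong)
    fix \<omega> assume "\<omega> \<in> space M"
    then have "(\<Sum>m. \<psi> \<omega> * indicator {\<omega>\<in>space M. n \<omega> = m} \<omega>) = (\<Sum>m\<in>{n \<omega>}. \<psi> \<omega> * indicator {\<omega>\<in>space M. n \<omega> = m} \<omega>)"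
      by (intro suminf_finite) auto
    then show "\<psi> \<omega> = (\<Sum>m. \<psi> \<omega> * indicator {\<omega>\<in>space M. n \<omega> = m} \<omega>)"
      using \<open>\<omega> \<in> space M\<close> by simp
  qed
  also have "\<dots> = (\<Sum>m. \<integral>\<^sup>+\<omega>. \<psi> \<omega> * indicator {\<omega>\<in>space M. n \<omega> = m} \<omega> \<partial>M)"
    by (rule nn_integral_suminf) measurable
  finally show ?thesis .
qed

text \<open>
  The freezing principle: in an expectation, a sample drawn after the history may be integrated out
  first, with the history held fixed. The sample size is part of the history, so the space over which
  the inner integral runs depends on \<open>\<omega>\<close>.
\<close>
lemma nn_integral_cond_iid_sample:
  assumes "prob_space M" "prob_space P" and sub: "subalgebra M G"
    and iid: "cond_iid_sample M G P n \<xi>"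
    and \<phi>: "\<And>m. \<phi> m \<in> borel_measurable (G \<Otimes>\<^sub>M PiM {..<m} (\<lambda>_. P))"
  shows "(\<lambda>\<omega>. \<integral>\<^sup>+s. \<phi> (n \<omega>) (\<omega>, s) \<partial>PiM {..<n \<omega>} (\<lambda>_. P)) \<in> borel_measurable M"
    and "(\<integral>\<^sup>+\<omega>. \<phi> (n \<omega>) (\<omega>, \<lambda>i\<in>{..<n \<omega>}. \<xi> i \<omega>) \<partial>M) =
      (\<integral>\<^sup>+\<omega>. \<integral>\<^sup>+s. \<phi> (n \<omega>) (\<omega>, s) \<partial>PiM {..<n \<omega>} (\<lambda>_. P) \<partial>M)"
proof -
  have "n \<in> measurable G (count_space UNIV)" and \<xi>: "\<And>i. \<xi> i \<in> measurable M P"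
    using iid by (auto simp: cond_iid_sample_def)
  then have n: "n \<in> measurable M (count_space UNIV)"
    by (auto intro: measurable_from_subalg[OF sub])
  have id: "(\<lambda>\<omega>. \<omega>) \<in> measurable M G" using sub by (rule measurable_from_subalg) simp
  have joint: "(\<lambda>\<omega>. (\<omega>, \<lambda>i\<in>{..<m}. \<xi> i \<omega>)) \<in> measurable M (G \<Otimes>\<^sub>M PiM {..<m} (\<lambda>_. P))" for m
    by (intro measurable_Pair id measurable_restrict \<xi>)
  have inner: "(\<lambda>\<omega>. \<integral>\<^sup>+s. \<phi> m (\<omega>, s) \<partial>PiM {..<m} (\<lambda>_. P)) \<in> borel_measurable M" for m
  proof -
    interpret Q: prob_space "PiM {..<m} (\<lambda>_. P)" by (rule prob_space_PiM) (rule assms)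
    show ?thesis
      using Q.borel_measurable_nn_integral_fst[OF \<phi>] by (rule measurable_from_subalg[OF sub])
  qed
  show meas: "(\<lambda>\<omega>. \<integral>\<^sup>+s. \<phi> (n \<omega>) (\<omega>, s) \<partial>PiM {..<n \<omega>} (\<lambda>_. P)) \<in> borel_measurable M"
    by (rule measurable_compose_countable[OF inner n])
  have "(\<lambda>\<omega>. \<phi> (n \<omega>) (\<omega>, \<lambda>i\<in>{..<n \<omega>}. \<xi> i \<omega>)) \<in> borel_measurable M"
    by (rule measurable_compose_countable[OF measurable_compose[OF joint \<phi>] n])
  from nn_integral_split_nat[OF n this]
  have "(\<integral>\<^sup>+\<omega>. \<phi> (n \<omega>) (\<omega>, \<lambda>i\<in>{..<n \<omega>}. \<xi> i \<omega>) \<partial>M) =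
      (\<Sum>m. \<integral>\<^sup>+\<omega>. \<phi> (n \<omega>) (\<omega>, \<lambda>i\<in>{..<n \<omega>}. \<xi> i \<omega>) * indicator {\<omega>\<in>space M. n \<omega> = m} \<omega> \<partial>M)" .
  also have "\<dots> = (\<Sum>m. \<integral>\<^sup>+\<omega>. \<phi> m (\<omega>, \<lambda>i\<in>{..<m}. \<xi> i \<omega>) * indicator {\<omega>\<in>space M. n \<omega> = m} \<omega> \<partial>M)"
    by (intro suminf_cong nn_integral_cong) (auto simp: indicator_def)
  also have "\<dots> = (\<Sum>m. \<integral>\<^sup>+\<omega>. (\<integral>\<^sup>+s. \<phi> m (\<omega>, s) \<partial>PiM {..<m} (\<lambda>_. P)) * indicator {\<omega>\<in>space M. n \<omega> = m} \<omega> \<partial>M)"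
    by (intro suminf_cong nn_integral_cond_iid_sample_fixed_size[OF assms(1-4) \<phi>])
  also have "\<dots> = (\<Sum>m. \<integral>\<^sup>+\<omega>. (\<integral>\<^sup>+s. \<phi> (n \<omega>) (\<omega>, s) \<partial>PiM {..<n \<omega>} (\<lambda>_. P)) * indicator {\<omega>\<in>space M. n \<omega> = m} \<omega> \<partial>M)"
    by (intro suminf_cong nn_integral_cong) (auto simp: indicator_def)
  also have "\<dots> = (\<integral>\<^sup>+\<omega>. \<integral>\<^sup>+s. \<phi> (n \<omega>) (\<omega>, s) \<partial>PiM {..<n \<omega>} (\<lambda>_. P) \<partial>M)"
    using nn_integral_split_nat[OF n meas] by simp
  finally show "(\<integral>\<^sup>+\<omega>. \<phi> (n \<omega>) (\<omega>, \<lambda>i\<in>{..<n \<omega>}. \<xi> i \<omega>) \<partial>M) =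
      (\<integral>\<^sup>+\<omega>. \<integral>\<^sup>+s. \<phi> (n \<omega>) (\<omega>, s) \<partial>PiM {..<n \<omega>} (\<lambda>_. P) \<partial>M)" .
qed

text \<open>
  The freezing principle for the conditional expectations that occur in the sample size tests. They
  become integrals against \<open>P\<close> with the history as a parameter.
\<close>
lemma nn_cond_exp_cond_iid_sample:
  assumes "prob_space M" "prob_space P" and sub: "subalgebra M G"
    and iid: "cond_iid_sample M G P n \<xi>"
    and n_pos: "\<forall>\<omega>\<in>space M. 1 \<le> n \<omega>"
    and \<phi>: "\<phi> \<in> borel_measurable (G \<Otimes>\<^sub>M P)"
  shows "AE \<omega> in M. nn_cond_exp M G (\<lambda>\<omega>. \<phi> (\<omega>, \<xi> 0 \<omega>)) \<omega> = (\<integral>\<^sup>+\<zeta>. \<phi> (\<omega>, \<zeta>) \<partial>P)"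
proof -
  interpret M: prob_space M by fact
  interpret P: prob_space P by fact
  interpret finite_measure_subalgebra M G by unfold_locales fact
  have spG: "space G = space M" using sub by (simp add: subalgebra_def)
  have \<xi>: "\<And>i. \<xi> i \<in> measurable M P"
    using iid by (auto simp: cond_iid_sample_def)
  have id: "(\<lambda>\<omega>. \<omega>) \<in> measurable M G" using sub by (rule measurable_from_subalg) simp
  have "AE \<omega> in M. (\<integral>\<^sup>+\<zeta>. \<phi> (\<omega>, \<zeta>) \<partial>P) = nn_cond_exp M G (\<lambda>\<omega>. \<phi> (\<omega>, \<xi> 0 \<omega>)) \<omega>"
  proof (rule nn_cond_exp_charact)
    show "(\<lambda>\<omega>. \<integral>\<^sup>+\<zeta>. \<phi> (\<omega>, \<zeta>) \<partial>P) \<in> borel_measurable G"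
      using P.borel_measurable_nn_integral_fst[OF \<phi>] by simp
    show "(\<lambda>\<omega>. \<phi> (\<omega>, \<xi> 0 \<omega>)) \<in> borel_measurable M"
      by (rule measurable_compose[OF measurable_Pair[OF id \<xi>] \<phi>])
    fix A assume A: "A \<in> sets G"
    \<comment> \<open>the value \<open>0\<close> at \<open>m = 0\<close> keeps \<open>\<psi>\<close> measurable: an empty sample has no coordinate \<open>0\<close>\<close>
    define \<psi> where "\<psi> m p = (if m = 0 then 0 else \<phi> (fst p, snd p 0) * indicator A (fst p))"
      for m :: nat and p :: "_ \<times> (nat \<Rightarrow> _)"
    have coord: "(\<lambda>s. s 0) \<in> measurable (PiM {..<m} (\<lambda>_. P)) P" if "0 < m" for m :: nat
      using that by (intro measurable_component_singleton) simp
    have \<psi>: "\<psi> m \<in> borel_measurable (G \<Otimes>\<^sub>M PiM {..<m} (\<lambda>_. P))" for m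
    proof (cases "m = 0")
      case False
      then have m: "0 < m" by simp
      have "(\<lambda>p. \<phi> (fst p, snd p 0) * indicator A (fst p)) \<in> borel_measurable (G \<Otimes>\<^sub>M PiM {..<m} (\<lambda>_. P))"
        by (intro borel_measurable_times_ennreal measurable_compose[OF _ \<phi>] measurable_Pair measurable_fst
            measurable_compose[OF measurable_snd coord[OF m]] measurable_compose[OF measurable_fst]
            borel_measurable_indicator A)
      then show ?thesis using m by (simp add: \<psi>_def[abs_def])
    qed (simp add: \<psi>_def[abs_def])
    have single: "(\<integral>\<^sup>+s. \<psi> m (\<omega>, s) \<partial>PiM {..<m} (\<lambda>_. P)) = (\<integral>\<^sup>+\<zeta>. \<phi> (\<omega>, \<zeta>) \<partial>P) * indicator A \<omega>"
      if \<omega>: "\<omega> \<in> space M" and m: "0 < m" for \<omega> m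
    proof -
      have meas: "(\<lambda>\<zeta>. \<phi> (\<omega>, \<zeta>)) \<in> borel_measurable P"
        using \<omega> spG by (intro measurable_compose[OF _ \<phi>] measurable_Pair1') simp
      have "distr (PiM {..<m} (\<lambda>_. P)) P (\<lambda>s. s 0) = P"
        using m by (intro distr_PiM_component) (auto intro: assms)
      then show ?thesis
        using nn_integral_distr[OF coord[OF m], of "\<lambda>\<zeta>. \<phi> (\<omega>, \<zeta>)"] meas m
        by (simp add: \<psi>_def nn_integral_multc measurable_compose[OF coord[OF m] meas])
    qed
    have pos: "0 < n \<omega>" if "\<omega> \<in> space M" for \<omega> using n_pos that by force
    have "(\<integral>\<^sup>+\<omega>\<in>A. \<phi> (\<omega>, \<xi> 0 \<omega>) \<partial>M) = (\<integral>\<^sup>+\<omega>. \<psi> (n \<omega>) (\<omega>, \<lambda>i\<in>{..<n \<omega>}. \<xi> i \<omega>) \<partial>M)"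
    proof (rule nn_integral_cong)
      fix \<omega> assume "\<omega> \<in> space M"
      from pos[OF this] show "\<phi> (\<omega>, \<xi> 0 \<omega>) * indicator A \<omega> = \<psi> (n \<omega>) (\<omega>, \<lambda>i\<in>{..<n \<omega>}. \<xi> i \<omega>)"
        by (simp add: \<psi>_def)
    qed
    also have "\<dots> = (\<integral>\<^sup>+\<omega>. \<integral>\<^sup>+s. \<psi> (n \<omega>) (\<omega>, s) \<partial>PiM {..<n \<omega>} (\<lambda>_. P) \<partial>M)"
      by (rule nn_integral_cond_iid_sample[OF assms(1-4) \<psi>])
    also have "\<dots> = (\<integral>\<^sup>+\<omega>\<in>A. (\<integral>\<^sup>+\<zeta>. \<phi> (\<omega>, \<zeta>) \<partial>P) \<partial>M)"
      using pos by (intro nn_integral_cong single)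
    finally show "(\<integral>\<^sup>+\<omega>\<in>A. \<phi> (\<omega>, \<xi> 0 \<omega>) \<partial>M) = (\<integral>\<^sup>+\<omega>\<in>A. (\<integral>\<^sup>+\<zeta>. \<phi> (\<omega>, \<zeta>) \<partial>P) \<partial>M)" .
  qed
  then show ?thesis by eventually_elim (rule sym)
qed

text \<open>
  The freezing principle for signed integrands. Integrability against \<open>P\<close> is a hypothesis for each
  \<open>\<omega>\<close> separately, since in the application it is available only almost everywhere.
\<close>
lemma real_cond_exp_cond_iid_sample:
  fixes \<phi> :: "'w \<times> 'z \<Rightarrow> real"
  assumes "prob_space M" "prob_space P" and sub: "subalgebra M G"
    and iid: "cond_iid_sample M G P n \<xi>"
    and n_pos: "\<forall>\<omega>\<in>space M. 1 \<le> n \<omega>"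
    and \<phi>[measurable]: "\<phi> \<in> borel_measurable (G \<Otimes>\<^sub>M P)"
  shows "AE \<omega> in M. integrable P (\<lambda>\<zeta>. \<phi> (\<omega>, \<zeta>)) \<longrightarrow>
    real_cond_exp M G (\<lambda>\<omega>. \<phi> (\<omega>, \<xi> 0 \<omega>)) \<omega> = (\<integral>\<zeta>. \<phi> (\<omega>, \<zeta>) \<partial>P)"
proof -
  have "(\<lambda>p. ennreal (\<phi> p)) \<in> borel_measurable (G \<Otimes>\<^sub>M P)"
    and "(\<lambda>p. ennreal (- \<phi> p)) \<in> borel_measurable (G \<Otimes>\<^sub>M P)"
    by measurable
  from this[THEN nn_cond_exp_cond_iid_sample[OF assms(1-4) n_pos]]
  show ?thesis
    by eventually_elim (simp add: real_cond_exp_def real_lebesgue_integral_def)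
qed

section \<open>Moments of a sample mean\<close>

text \<open>
  Distinct members of a sample are uncorrelated: Fubini's theorem applies to the product over all
  coordinates, of which all but two contribute the constant factor \<open>1\<close>.
\<close>
lemma (in prob_space) integral_PiM_two_coordinates:
  fixes u v :: "'a \<Rightarrow> real"
  assumes uv: "integrable M u" "integrable M v" and ij: "i < m" "j < m" "i \<noteq> (j::nat)"
  shows "integrable (PiM {..<m} (\<lambda>_. M)) (\<lambda>s. u (s i) * v (s j))"
    and "(\<integral>s. u (s i) * v (s j) \<partial>PiM {..<m} (\<lambda>_. M)) = expectation u * expectation v"
proof -
  interpret prod: product_sigma_finite "\<lambda>_::nat. M" ..
  define f where "f k = (if k = i then u else if k = j then v else (\<lambda>_. 1))" for k
  have f: "integrable M (f k)" for k using uv by (simp add: f_def)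
  have *: "(\<Prod>k<m. g k) = g i * g j" if "\<And>k. k \<noteq> i \<Longrightarrow> k \<noteq> j \<Longrightarrow> g k = 1" for g :: "nat \<Rightarrow> real"
  proof -
    have "(\<Prod>k<m. g k) = (\<Prod>k\<in>{i, j}. g k)"
      using ij that by (intro prod.mono_neutral_right) auto
    then show ?thesis using ij by simp
  qed
  have f2: "(\<Prod>k<m. f k (s k)) = u (s i) * v (s j)" for s
    using ij by (subst *) (auto simp: f_def)
  have "(\<Prod>k<m. expectation (f k)) = expectation u * expectation v"
    using ij by (subst *) (auto simp: f_def prob_space)
  then show "(\<integral>s. u (s i) * v (s j) \<partial>PiM {..<m} (\<lambda>_. M)) = expectation u * expectation v"
    using prod.product_integral_prod[of "{..<m}" f] f by (simp add: f2)
  show "integrable (PiM {..<m} (\<lambda>_. M)) (\<lambda>s. u (s i) * v (s j))"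
    using prod.product_integrable_prod[of "{..<m}" f] f by (simp add: f2)
qed

lemma (in prob_space) integral_PiM_coordinate:
  fixes u :: "'a \<Rightarrow> 'b::{banach, second_countable_topology}"
  assumes u: "integrable M u" and i: "i < m"
  shows "integrable (PiM {..<m} (\<lambda>_. M)) (\<lambda>s. u (s i))"
    and "(\<integral>s. u (s i) \<partial>PiM {..<m} (\<lambda>_. M)) = expectation u"
proof -
  have coord: "(\<lambda>s. s i) \<in> measurable (PiM {..<m} (\<lambda>_. M)) M"
    using i by (intro measurable_component_singleton) simp
  have distr: "distr (PiM {..<m} (\<lambda>_. M)) M (\<lambda>s. s i) = M"
    using i by (intro distr_PiM_component[where M = "\<lambda>_. M"]) (auto intro: prob_space_axioms)
  show "integrable (PiM {..<m} (\<lambda>_. M)) (\<lambda>s. u (s i))"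
    using integrable_distr[OF coord, of u] u by (simp add: distr)
  show "(\<integral>s. u (s i) \<partial>PiM {..<m} (\<lambda>_. M)) = expectation u"
    using integral_distr[OF coord, of u] u by (simp add: distr)
qed

text \<open>
  The bias-variance decomposition for a sample mean. For the centred variable \<open>W\<close>, the squared norm of
  the sum expands into a double sum over the sample in which the off-diagonal terms have mean zero.
\<close>
lemma (in prob_space) sample_mean_second_moment:
  fixes Y :: "'a \<Rightarrow> 'b::euclidean_space"
  assumes meas: "Y \<in> borel_measurable M" and sq: "integrable M (\<lambda>\<zeta>. (norm (Y \<zeta>))\<^sup>2)"
    and m: "0 < m"
  defines "S \<equiv> \<lambda>s. (1 / real m) *\<^sub>R (\<Sum>i<m. Y (s i))"
  shows "integrable (PiM {..<m} (\<lambda>_. M)) S"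
    and "(\<integral>s. S s \<partial>PiM {..<m} (\<lambda>_. M)) = expectation Y"
    and "integrable (PiM {..<m} (\<lambda>_. M)) (\<lambda>s. (norm (S s))\<^sup>2)"
    and "(\<integral>s. (norm (S s))\<^sup>2 \<partial>PiM {..<m} (\<lambda>_. M)) =
      (norm (expectation Y))\<^sup>2 + expectation (\<lambda>\<zeta>. (norm (Y \<zeta> - expectation Y))\<^sup>2) / real m"
proof -
  let ?Q = "PiM {..<m} (\<lambda>_. M)"
  define c where "c = expectation Y"
  interpret Q: prob_space ?Q by (rule prob_space_PiM) (rule prob_space_axioms)
  have Y: "integrable M Y"
    using square_integrable_imp_integrable[of "\<lambda>\<zeta>. norm (Y \<zeta>)"] meas sq
    by (simp add: integrable_norm_iff)
  show S: "integrable ?Q S"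
    unfolding S_def
    by (intro integrable_scaleR_right Bochner_Integration.integrable_sum integral_PiM_coordinate Y) auto
  show ES: "(\<integral>s. S s \<partial>?Q) = expectation Y"
    using m unfolding S_def by (simp add: integral_PiM_coordinate Y sum_constant_scaleR)
  define W where "W \<zeta> = Y \<zeta> - c" for \<zeta>
  have W: "integrable M W" and EW: "expectation W = 0"
    using Y by (simp_all add: W_def[abs_def] c_def prob_space)
  have sqW: "integrable M (\<lambda>\<zeta>. (norm (W \<zeta>))\<^sup>2)"
  proof -
    have "(\<lambda>\<zeta>. (norm (W \<zeta>))\<^sup>2) = (\<lambda>\<zeta>. (norm (Y \<zeta>))\<^sup>2 - 2 * (Y \<zeta> \<bullet> c) + (norm c)\<^sup>2)"
      by (auto simp: W_def power2_norm_eq_inner inner_diff_left inner_diff_right inner_commute)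
    then show ?thesis using sq Y by simp
  qed
  have sqWb: "integrable M (\<lambda>\<zeta>. (W \<zeta> \<bullet> b) * (W \<zeta> \<bullet> b))" if "b \<in> Basis" for b
    using sqW
  proof (rule Bochner_Integration.integrable_bound)
    show "(\<lambda>\<zeta>. (W \<zeta> \<bullet> b) * (W \<zeta> \<bullet> b)) \<in> borel_measurable M"
      using borel_measurable_integrable[OF W] by measurable
    show "AE \<zeta> in M. norm ((W \<zeta> \<bullet> b) * (W \<zeta> \<bullet> b)) \<le> norm ((norm (W \<zeta>))\<^sup>2)"
    proof (rule AE_I2)
      fix \<zeta>
      have "\<bar>W \<zeta> \<bullet> b\<bar>\<^sup>2 \<le> (norm (W \<zeta>))\<^sup>2"
        using that by (intro power_mono Basis_le_norm) auto
      then show "norm ((W \<zeta> \<bullet> b) * (W \<zeta> \<bullet> b)) \<le> norm ((norm (W \<zeta>))\<^sup>2)"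
        by (simp add: power2_eq_square)
    qed
  qed
  have Wb: "integrable M (\<lambda>\<zeta>. W \<zeta> \<bullet> b)" "expectation (\<lambda>\<zeta>. W \<zeta> \<bullet> b) = 0" for b
    using W EW by (simp_all)
  have prod_b: "integrable ?Q (\<lambda>s. (W (s i) \<bullet> b) * (W (s j) \<bullet> b))"
      "(\<integral>s. (W (s i) \<bullet> b) * (W (s j) \<bullet> b) \<partial>?Q) =
        (if i = j then expectation (\<lambda>\<zeta>. (W \<zeta> \<bullet> b) * (W \<zeta> \<bullet> b)) else 0)"
    if "i < m" "j < m" "b \<in> Basis" for i j b
    using that integral_PiM_two_coordinates[OF Wb(1) Wb(1), of i m j b b]
      integral_PiM_coordinate[OF sqWb, of b i m]
    by (auto simp: Wb(2))
  have expand: "(norm (\<Sum>i<m. W (s i)))\<^sup>2 = (\<Sum>i<m. \<Sum>j<m. \<Sum>b\<in>Basis. (W (s i) \<bullet> b) * (W (s j) \<bullet> b))" for s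
    by (simp add: power2_norm_eq_inner inner_sum_left inner_sum_right euclidean_inner[symmetric])
      (rule sum.swap)
  have sum_W: "integrable ?Q (\<lambda>s. (norm (\<Sum>i<m. W (s i)))\<^sup>2)"
    unfolding expand by (intro Bochner_Integration.integrable_sum prod_b) auto
  have sum_EW: "(\<integral>s. (norm (\<Sum>i<m. W (s i)))\<^sup>2 \<partial>?Q) = real m * expectation (\<lambda>\<zeta>. (norm (W \<zeta>))\<^sup>2)"
  proof -
    have "(\<integral>s. (norm (\<Sum>i<m. W (s i)))\<^sup>2 \<partial>?Q) =
        (\<Sum>i<m. \<Sum>j<m. \<Sum>b\<in>Basis. if i = j then expectation (\<lambda>\<zeta>. (W \<zeta> \<bullet> b) * (W \<zeta> \<bullet> b)) else 0)"
      unfolding expand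
      by (subst Bochner_Integration.integral_sum;
          (intro sum.cong refl Bochner_Integration.integrable_sum)?; (simp add: prod_b)?)+
    also have "\<dots> = (\<Sum>i<m. \<Sum>b\<in>Basis. expectation (\<lambda>\<zeta>. (W \<zeta> \<bullet> b) * (W \<zeta> \<bullet> b)))"
      by (subst sum.swap[of _ Basis]) (simp add: sum.delta)
    also have "\<dots> = real m * expectation (\<lambda>\<zeta>. \<Sum>b\<in>Basis. (W \<zeta> \<bullet> b) * (W \<zeta> \<bullet> b))"
      by (simp add: sqWb)
    finally show ?thesis
      by (simp add: power2_norm_eq_inner euclidean_inner[symmetric])
  qed
  have S_W: "S s = c + (1 / real m) *\<^sub>R (\<Sum>i<m. W (s i))" for s
    using m by (simp add: S_def W_def sum_subtractf sum_constant_scaleR scaleR_diff_right)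
  have "(norm (S s))\<^sup>2 = 2 * (S s \<bullet> c) - (norm c)\<^sup>2 + (norm (\<Sum>i<m. W (s i)))\<^sup>2 / (real m)\<^sup>2" for s
  proof -
    have "(norm (\<Sum>i<m. W (s i)))\<^sup>2 / (real m)\<^sup>2 = (norm (S s - c))\<^sup>2"
      by (simp add: S_W power_divide)
    then show ?thesis
      by (simp add: power2_norm_eq_inner inner_diff_left inner_diff_right inner_commute)
  qed
  note sq_S = this
  show "integrable ?Q (\<lambda>s. (norm (S s))\<^sup>2)"
    unfolding sq_S using S sum_W by simp
  have "(\<integral>s. (norm (S s))\<^sup>2 \<partial>?Q) = 2 * (c \<bullet> c) - (norm c)\<^sup>2 + real m * expectation (\<lambda>\<zeta>. (norm (W \<zeta>))\<^sup>2) / (real m)\<^sup>2"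
    unfolding sq_S using S sum_W by (simp add: Q.prob_space sum_EW ES c_def)
  then show "(\<integral>s. (norm (S s))\<^sup>2 \<partial>?Q) =
      (norm (expectation Y))\<^sup>2 + expectation (\<lambda>\<zeta>. (norm (Y \<zeta> - expectation Y))\<^sup>2) / real m"
    using m by (simp add: dot_square_norm c_def[symmetric] W_def power2_eq_square)
qed

section \<open>Expected descent in one iteration\<close>

text \<open>
  Pythagoras for \<open>q - p\<close> along \<open>p\<close> and orthogonal to it. The two terms are the quantities which the
  inner product test and the orthogonality condition control, so that together the tests bound the
  whole variance. If \<open>p = 0\<close>, division by zero makes the first term vanish and the second one
  \<open>(norm q)\<^sup>2\<close>.
\<close>
lemma norm_diff_square_split:
  fixes p q :: "'a::real_inner"
  shows "(norm (q - p))\<^sup>2 =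
    (p \<bullet> q - (norm p)\<^sup>2)\<^sup>2 / (norm p)\<^sup>2 + (norm (q - ((q \<bullet> p) / (norm p)\<^sup>2) *\<^sub>R p))\<^sup>2"
proof (cases "p = 0")
  case False
  define r t where "r = p \<bullet> p" and "t = (q \<bullet> p) / r"
  have r: "0 < r" using False by (simp add: r_def)
  have qp: "q \<bullet> p = t * r" using r by (simp add: t_def)
  have "(p \<bullet> q - r)\<^sup>2 / r = (t - 1)\<^sup>2 * r"
    using r by (simp add: inner_commute[of p q] qp field_simps power2_eq_square)
  moreover have "(norm (q - t *\<^sub>R p))\<^sup>2 = q \<bullet> q - t\<^sup>2 * r"
    unfolding power2_norm_eq_inner
    by (simp add: inner_diff_left inner_diff_right inner_commute[of p q] qp
        r_def[symmetric] power2_eq_square algebra_simps)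
  moreover have "(norm (q - p))\<^sup>2 = q \<bullet> q - 2 * (t * r) + r"
    by (simp add: power2_norm_eq_inner inner_diff_left inner_diff_right inner_commute[of p q] qp r_def)
  ultimately show ?thesis
    unfolding power2_norm_eq_inner[of p] r_def[symmetric] t_def[symmetric]
    by (simp add: power2_eq_square algebra_simps)
qed simp

text \<open>
  Translates the form in which the sample size tests are stated, with values in \<open>[0, \<infinity>]\<close>, into
  integrability and a bound between real numbers.
\<close>
lemma integral_le_of_nn_integral_divide_le:
  fixes h :: "'a \<Rightarrow> real"
  assumes meas: "h \<in> borel_measurable M" and nonneg: "\<And>z. 0 \<le> h z" and m: "0 < m" and c: "0 \<le> c"
    and le: "(\<integral>\<^sup>+z. ennreal (h z) \<partial>M) / of_nat m \<le> ennreal c"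
  shows "integrable M h" and "(\<integral>z. h z \<partial>M) \<le> real m * c"
proof -
  have "(\<integral>\<^sup>+z. ennreal (h z) \<partial>M) = (\<integral>\<^sup>+z. ennreal (h z) \<partial>M) / of_nat m * of_nat m"
    using m by (simp add: ennreal_divide_times of_nat_less_top)
  also have "\<dots> \<le> ennreal c * of_nat m"
    using le by (rule mult_right_mono) simp
  also have "\<dots> = ennreal (real m * c)"
    using c by (simp add: ennreal_of_nat_eq_real_of_nat ennreal_mult[symmetric] mult.commute)
  finally have bound: "(\<integral>\<^sup>+z. ennreal (h z) \<partial>M) \<le> ennreal (real m * c)" .
  then show int: "integrable M h"
    using meas nonneg by (intro integrableI_nonneg) (auto simp: top.not_eq_extremum intro: le_less_trans)
  show "(\<integral>z. h z \<partial>M) \<le> real m * c"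
    using bound c by (intro integral_real_bounded) auto
qed

text \<open>
  One iteration with the history fixed: \<open>v\<close> is the iterate, \<open>A\<close> the matrix, \<open>m\<close> the sample size, and
  only the sample is random. Write \<open>p = A *v grad F v\<close>. The tests bound the second moment of the
  preconditioned batch gradient by \<open>(1 + \<theta>\<^sup>2 + \<nu>\<^sup>2) * (norm p)\<^sup>2\<close>, which is at most \<open>1 + \<theta>\<^sup>2 + \<nu>\<^sup>2\<close>
  times \<open>\<Lambda>2 * (grad F v \<bullet> p)\<close>, while the expected decrease of first order is \<open>a * (grad F v \<bullet> p)\<close>. The steplength is such that the quadratic term of the descent
  lemma uses up at most half of that decrease.
\<close>
lemma expected_descent:
  fixes F :: "real ^ 'n \<Rightarrow> real" and A :: "real ^ 'n ^ 'n" and g :: "'z \<Rightarrow> real ^ 'n"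
  assumes "prob_space P"
    and C2: "twice_continuously_differentiable F"
    and L: "0 < L" and hessian_le: "\<And>v. hessian F v \<preceq>\<^sub>L L *\<^sub>R mat 1"
    and lower: "\<And>v. Fm \<le> F v"
    and g[measurable]: "g \<in> borel_measurable P"
    and sq: "(\<integral>\<^sup>+\<zeta>. ennreal ((norm (g \<zeta>))\<^sup>2) \<partial>P) < \<infinity>"
    and mean: "\<And>j. (\<integral>\<zeta>. g \<zeta> $ j \<partial>P) = grad F v $ j"
    and pd: "pos_def A" and \<Lambda>1: "0 < \<Lambda>1" "\<Lambda>1 *\<^sub>R mat 1 \<preceq>\<^sub>L A" and \<Lambda>2: "A \<preceq>\<^sub>L \<Lambda>2 *\<^sub>R mat 1" "0 < \<Lambda>2"
    and m: "0 < m"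
    and inner_product: "(\<integral>\<^sup>+\<zeta>. ennreal (((A *v grad F v) \<bullet> (A *v g \<zeta>) - (norm (A *v grad F v))\<^sup>2)\<^sup>2) \<partial>P) / of_nat m
        \<le> ennreal (\<theta>\<^sup>2 * norm (A *v grad F v) ^ 4)"
    and orthogonal: "(\<integral>\<^sup>+\<zeta>. ennreal ((norm (A *v g \<zeta> -
          ((A *v g \<zeta>) \<bullet> (A *v grad F v) / (norm (A *v grad F v))\<^sup>2) *\<^sub>R (A *v grad F v)))\<^sup>2) \<partial>P) / of_nat m
        \<le> ennreal (\<nu>\<^sup>2 * (norm (A *v grad F v))\<^sup>2)"
    and a: "0 < a" "a \<le> 1 / ((1 + \<theta>\<^sup>2 + \<nu>\<^sup>2) * L * \<Lambda>2)"
  shows "(\<integral>\<^sup>+s. ennreal (F (v - a *\<^sub>R (A *v ((1 / real m) *\<^sub>R (\<Sum>i<m. g (s i))))) - Fm) \<partial>PiM {..<m} (\<lambda>_. P))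
      + ennreal (a * \<Lambda>1 / 2 * (norm (grad F v))\<^sup>2) \<le> ennreal (F v - Fm)"
proof -
  interpret P: prob_space P by fact
  let ?Q = "PiM {..<m} (\<lambda>_. P)"
  interpret Q: prob_space ?Q by (rule prob_space_PiM) (rule assms)
  define b p q where "b = grad F v" and "p = A *v b" and "q \<zeta> = A *v g \<zeta>" for \<zeta>
  have sq_g: "integrable P (\<lambda>\<zeta>. (norm (g \<zeta>))\<^sup>2)"
    using sq by (intro integrableI_nonneg) auto
  have int_g: "integrable P g"
    using P.square_integrable_imp_integrable[of "\<lambda>\<zeta>. norm (g \<zeta>)"] sq_g
    by (simp add: integrable_norm_iff)
  have "(\<integral>\<zeta>. g \<zeta> \<partial>P) = b"
    using integral_bounded_linear[OF bounded_linear_vec_nth int_g] mean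
    by (simp add: vec_eq_iff b_def)
  then have mean_q: "P.expectation q = p"
    using integral_bounded_linear[OF matrix_vector_mul_bounded_linear int_g, of A]
    by (simp add: q_def[abs_def] p_def)
  have q[measurable]: "q \<in> borel_measurable P"
    unfolding q_def[abs_def] by measurable
  have sq_q: "integrable P (\<lambda>\<zeta>. (norm (q \<zeta>))\<^sup>2)"
  proof -
    obtain K where K: "norm (A *v u) \<le> norm u * K" for u
      using bounded_linear.bounded[OF matrix_vector_mul_bounded_linear[of A]] by blast
    have "(norm (q \<zeta>))\<^sup>2 \<le> (norm (g \<zeta>))\<^sup>2 * K\<^sup>2" for \<zeta>
      using power_mono[OF K[of "g \<zeta>"], of 2] by (simp add: q_def power_mult_distrib)
    then show ?thesis
      by (intro Bochner_Integration.integrable_bound[OF integrable_mult_left[OF sq_g, of "K\<^sup>2"]]) auto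
  qed
  define S where "S s = (1 / real m) *\<^sub>R (\<Sum>i<m. q (s i))" for s
  note S = P.sample_mean_second_moment[OF q sq_q m, folded S_def, unfolded mean_q]
  have A_S: "A *v ((1 / real m) *\<^sub>R (\<Sum>i<m. g (s i))) = S s" for s
    by (simp add: S_def q_def matrix_vector_mult_scaleR linear_sum[OF matrix_vector_mul_linear])
  have var: "P.expectation (\<lambda>\<zeta>. (norm (q \<zeta> - p))\<^sup>2) / real m \<le> (\<theta>\<^sup>2 + \<nu>\<^sup>2) * (norm p)\<^sup>2"
  proof -
    let ?u = "\<lambda>\<zeta>. (p \<bullet> q \<zeta> - (norm p)\<^sup>2)\<^sup>2" and ?w = "\<lambda>\<zeta>. (norm (q \<zeta> - ((q \<zeta> \<bullet> p) / (norm p)\<^sup>2) *\<^sub>R p))\<^sup>2"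
    have "(\<integral>\<^sup>+\<zeta>. ennreal (?u \<zeta>) \<partial>P) / of_nat m \<le> ennreal (\<theta>\<^sup>2 * norm p ^ 4)"
      using inner_product by (simp add: q_def p_def b_def)
    moreover have "?u \<in> borel_measurable P" by measurable
    ultimately have u: "integrable P ?u" "P.expectation ?u \<le> real m * (\<theta>\<^sup>2 * norm p ^ 4)"
      using integral_le_of_nn_integral_divide_le[of ?u P m "\<theta>\<^sup>2 * norm p ^ 4"] m
      by (simp_all only: zero_le_power2 mult_nonneg_nonneg zero_le_power norm_ge_zero)
    have "(\<integral>\<^sup>+\<zeta>. ennreal (?w \<zeta>) \<partial>P) / of_nat m \<le> ennreal (\<nu>\<^sup>2 * (norm p)\<^sup>2)"
      using orthogonal by (simp add: q_def p_def b_def)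
    moreover have "?w \<in> borel_measurable P" by measurable
    ultimately have w: "integrable P ?w" "P.expectation ?w \<le> real m * (\<nu>\<^sup>2 * (norm p)\<^sup>2)"
      using integral_le_of_nn_integral_divide_le[of ?w P m "\<nu>\<^sup>2 * (norm p)\<^sup>2"] m
      by (simp_all only: zero_le_power2 mult_nonneg_nonneg)
    have "P.expectation (\<lambda>\<zeta>. (norm (q \<zeta> - p))\<^sup>2) = P.expectation ?u / (norm p)\<^sup>2 + P.expectation ?w"
    proof -
      have "(\<lambda>\<zeta>. (norm (q \<zeta> - p))\<^sup>2) = (\<lambda>\<zeta>. ?u \<zeta> / (norm p)\<^sup>2 + ?w \<zeta>)"
        by (rule ext) (rule norm_diff_square_split)
      then show ?thesis using u w by simp
    qed
    also have "\<dots> \<le> real m * (\<theta>\<^sup>2 * norm p ^ 4) / (norm p)\<^sup>2 + real m * (\<nu>\<^sup>2 * (norm p)\<^sup>2)"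
      using u w by (intro add_mono divide_right_mono) auto
    also have "\<dots> = real m * ((\<theta>\<^sup>2 + \<nu>\<^sup>2) * (norm p)\<^sup>2)"
      by (cases "p = 0") (simp_all add: field_simps power2_eq_square power4_eq_xxxx)
    finally show ?thesis using m by (simp add: field_simps)
  qed
  \<comment> \<open>the upper bound on the new value of \<open>F - Fm\<close> that the descent lemma provides\<close>
  define R where "R s = F v - Fm - a * (b \<bullet> S s) + L * a\<^sup>2 / 2 * (norm (S s))\<^sup>2" for s
  have step: "F (v - a *\<^sub>R S s) - Fm \<le> R s" for s
    using descent_lemma[OF C2 hessian_le, of v "- a *\<^sub>R S s"]
    by (simp add: R_def b_def power_mult_distrib algebra_simps)
  then have R_nonneg: "0 \<le> R s" for s
    using lower[of "v - a *\<^sub>R S s"] by (smt (verit))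
  have int_R: "integrable ?Q R"
    unfolding R_def[abs_def] using S by simp
  have sym: "transpose A = A" and psd: "0 \<le> u \<bullet> (A *v u)" for u
    using pd by (auto simp: pos_def_def le_less) (metis inner_zero_left)
  have p_le: "(norm p)\<^sup>2 \<le> \<Lambda>2 * (b \<bullet> p)"
    unfolding p_def by (rule norm_matrix_vector_square_le[OF sym psd \<Lambda>2])
  have b_le: "\<Lambda>1 * (norm b)\<^sup>2 \<le> b \<bullet> p"
    using \<Lambda>1(2) by (auto simp: loewner_le_def pos_semidef_def matrix_vector_mult_diff_rdistrib inner_diff_right
        scaleR_matrix_vector_assoc[symmetric] power2_norm_eq_inner p_def)
  define \<kappa> where "\<kappa> = 1 + \<theta>\<^sup>2 + \<nu>\<^sup>2"
  have \<kappa>: "0 < \<kappa>" by (simp add: \<kappa>_def add_pos_nonneg)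
  have "(\<integral>s. R s \<partial>?Q) \<le> F v - Fm - a * (b \<bullet> p) + L * a\<^sup>2 / 2 * (\<kappa> * (norm p)\<^sup>2)"
  proof -
    have "(\<integral>s. R s \<partial>?Q) = F v - Fm - a * (b \<bullet> p) + L * a\<^sup>2 / 2 * (\<integral>s. (norm (S s))\<^sup>2 \<partial>?Q)"
      unfolding R_def[abs_def] using S by (simp add: Q.prob_space)
    moreover have "(\<integral>s. (norm (S s))\<^sup>2 \<partial>?Q) \<le> \<kappa> * (norm p)\<^sup>2"
      using S(4) var by (simp add: \<kappa>_def algebra_simps)
    ultimately show ?thesis using L by (simp add: mult_left_mono)
  qed
  also have "\<dots> \<le> F v - Fm - a / 2 * (b \<bullet> p)"
  proof -
    have "0 \<le> b \<bullet> p" using psd[of b] by (simp add: p_def)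
    have "L * a\<^sup>2 / 2 * (\<kappa> * (norm p)\<^sup>2) \<le> L * a\<^sup>2 / 2 * (\<kappa> * (\<Lambda>2 * (b \<bullet> p)))"
      using p_le \<kappa> L by (intro mult_left_mono) auto
    also have "\<dots> = (a * (\<kappa> * L * \<Lambda>2)) * (a / 2 * (b \<bullet> p))"
      by (simp add: power2_eq_square)
    also have "\<dots> \<le> 1 * (a / 2 * (b \<bullet> p))"
      using a \<kappa> L \<Lambda>2(2) \<open>0 \<le> b \<bullet> p\<close>
      by (intro mult_right_mono) (simp_all add: \<kappa>_def[symmetric] pos_le_divide_eq)
    finally show ?thesis by simp
  qed
  also have "\<dots> \<le> F v - Fm - a * \<Lambda>1 / 2 * (norm b)\<^sup>2"
    using mult_left_mono[OF b_le, of "a / 2"] a by simp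
  finally have ER: "(\<integral>s. R s \<partial>?Q) + a * \<Lambda>1 / 2 * (norm b)\<^sup>2 \<le> F v - Fm" by simp
  have "(\<integral>\<^sup>+s. ennreal (F (v - a *\<^sub>R S s) - Fm) \<partial>?Q) + ennreal (a * \<Lambda>1 / 2 * (norm b)\<^sup>2)
      \<le> (\<integral>\<^sup>+s. ennreal (R s) \<partial>?Q) + ennreal (a * \<Lambda>1 / 2 * (norm b)\<^sup>2)"
    by (intro add_right_mono nn_integral_mono ennreal_leI step)
  also have "(\<integral>\<^sup>+s. ennreal (R s) \<partial>?Q) = ennreal (\<integral>s. R s \<partial>?Q)"
    using int_R R_nonneg by (intro nn_integral_eq_integral) auto
  also have "ennreal (\<integral>s. R s \<partial>?Q) + ennreal (a * \<Lambda>1 / 2 * (norm b)\<^sup>2) =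
      ennreal ((\<integral>s. R s \<partial>?Q) + a * \<Lambda>1 / 2 * (norm b)\<^sup>2)"
    using R_nonneg a \<Lambda>1(1) by (intro ennreal_plus[symmetric] Bochner_Integration.integral_nonneg) auto
  also have "\<dots> \<le> ennreal (F v - Fm)"
    using ER by (rule ennreal_leI)
  finally show ?thesis
    by (simp add: A_S b_def)
qed

context stochastic_quasi_newton
begin

lemma measurable_loss_grad_iterate:
  "(\<lambda>p. loss_grad f (snd p) (x k (fst p))) \<in> borel_measurable (G k \<Otimes>\<^sub>M P)"
proof -
  have "(\<lambda>(v, \<zeta>). grad (\<lambda>u. f u \<zeta>) v) \<in> borel_measurable (borel \<Otimes>\<^sub>M P)"
    by (intro borel_measurable_grad loss_differentiable borel_measurable_integrable loss_integrable)
  moreover have "(\<lambda>p. (x k (fst p), snd p)) \<in> measurable (G k \<Otimes>\<^sub>M P) (borel \<Otimes>\<^sub>M P)"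
    by (intro measurable_Pair measurable_compose[OF measurable_fst iterate_in_history] measurable_snd)
  ultimately show ?thesis
    using measurable_compose by (fastforce simp: loss_grad_def)
qed

text \<open>
  The moment hypotheses on the stochastic gradient, as properties of the law \<open>P\<close> of a data point,
  for almost every history.
\<close>
lemma data_point_moments:
  "AE \<omega> in M. (\<integral>\<^sup>+\<zeta>. ennreal ((norm (loss_grad f \<zeta> (x k \<omega>)))\<^sup>2) \<partial>P) < \<infinity> \<and>
     (\<forall>j. (\<integral>\<zeta>. loss_grad f \<zeta> (x k \<omega>) $ j \<partial>P) = grad (expected_loss P f) (x k \<omega>) $ j)"
proof -
  have N_pos: "\<forall>\<omega>\<in>space M. 1 \<le> N k \<omega>" using sample_size_ge_1 by blast
  note iid = prob_space_axioms data.prob_space_axioms history_subalgebra[of k] sample_iid[of k] N_pos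
  note g[measurable] = measurable_loss_grad_iterate[of k]
  have g_j: "(\<lambda>p. loss_grad f (snd p) (x k (fst p)) $ j) \<in> borel_measurable (G k \<Otimes>\<^sub>M P)" for j
    by (rule measurable_compose[OF g]) (intro borel_measurable_continuous_onI continuous_intros)
  have "AE \<omega> in M. \<forall>j\<in>UNIV. integrable P (\<lambda>\<zeta>. loss_grad f \<zeta> (x k \<omega>) $ j) \<longrightarrow>
      real_cond_exp M (G k) (\<lambda>\<omega>. loss_grad f (\<xi> k 0 \<omega>) (x k \<omega>) $ j) \<omega> = (\<integral>\<zeta>. loss_grad f \<zeta> (x k \<omega>) $ j \<partial>P)"
    using real_cond_exp_cond_iid_sample[OF iid g_j] by (intro AE_finite_allI) simp_all
  moreover have "(\<lambda>p. ennreal ((norm (loss_grad f (snd p) (x k (fst p))))\<^sup>2)) \<in> borel_measurable (G k \<Otimes>\<^sub>M P)"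
    by measurable
  note nn_cond_exp_cond_iid_sample[OF iid this]
  ultimately show ?thesis
    using finite_second_moment[of k] unbiased[of k] AE_space
  proof eventually_elim
    case (elim \<omega>)
    have [measurable]: "(\<lambda>\<zeta>. loss_grad f \<zeta> (x k \<omega>)) \<in> borel_measurable P"
      using measurable_compose[OF measurable_Pair1' g, of \<omega>] elim(5) history_subalgebra[of k]
      by (simp add: subalgebra_def)
    have sq: "(\<integral>\<^sup>+\<zeta>. ennreal ((norm (loss_grad f \<zeta> (x k \<omega>)))\<^sup>2) \<partial>P) < \<infinity>"
      using elim(2,3) by simp
    then have "integrable P (\<lambda>\<zeta>. (norm (loss_grad f \<zeta> (x k \<omega>)))\<^sup>2)"
      by (intro integrableI_nonneg) auto
    then have "integrable P (\<lambda>\<zeta>. loss_grad f \<zeta> (x k \<omega>))"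
      using data.square_integrable_imp_integrable[of "\<lambda>\<zeta>. norm (loss_grad f \<zeta> (x k \<omega>))"]
      by (simp add: integrable_norm_iff)
    then have "integrable P (\<lambda>\<zeta>. loss_grad f \<zeta> (x k \<omega>) $ j)" for j
      by (rule integrable_bounded_linear[OF bounded_linear_vec_nth])
    then show ?case
      using elim(1,4) sq by simp
  qed
qed

text \<open>
  The estimate for a fixed history, integrated over the history. Stating it with \<open>Fm\<close> subtracted and
  with values in \<open>[0, \<infinity>]\<close> makes it meaningful before anything is known to be integrable; this is
  what lets integrability come out of the recursion instead of going into it.
\<close>
lemma expected_objective_decrease:
  assumes F_eq: "F = expected_loss P f"
    and C2: "twice_continuously_differentiable F"
    and L: "0 < L" and hessian_le: "\<And>v. hessian F v \<preceq>\<^sub>L L *\<^sub>R mat 1"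
    and lower: "\<And>v. Fm \<le> F v"
    and \<Lambda>: "0 < \<Lambda>1" "\<Lambda>1 \<le> \<Lambda>2"
    and inner_product_test: "inner_product_qn_test M (G k) \<theta> (N k)
          (\<lambda>\<omega>. H k \<omega> *v grad F (x k \<omega>)) (\<lambda>\<omega>. H k \<omega> *v loss_grad f (\<xi> k 0 \<omega>) (x k \<omega>))"
    and orthogonality: "orthogonality_condition M (G k) \<nu> (N k)
          (\<lambda>\<omega>. H k \<omega> *v grad F (x k \<omega>)) (\<lambda>\<omega>. H k \<omega> *v loss_grad f (\<xi> k 0 \<omega>) (x k \<omega>))"
    and eigenvalue_bounds: "AE \<omega> in M. \<Lambda>1 *\<^sub>R mat 1 \<preceq>\<^sub>L H k \<omega> \<and> H k \<omega> \<preceq>\<^sub>L \<Lambda>2 *\<^sub>R mat 1"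
    and a: "\<alpha> k = a" "0 < a" "a \<le> 1 / ((1 + \<theta>\<^sup>2 + \<nu>\<^sup>2) * L * \<Lambda>2)"
  shows "(\<integral>\<^sup>+\<omega>. ennreal (F (x (Suc k) \<omega>) - Fm) \<partial>M)
      + (\<integral>\<^sup>+\<omega>. ennreal (a * \<Lambda>1 / 2 * (norm (grad F (x k \<omega>)))\<^sup>2) \<partial>M)
    \<le> (\<integral>\<^sup>+\<omega>. ennreal (F (x k \<omega>) - Fm) \<partial>M)"
proof -
  have N_pos: "\<forall>\<omega>\<in>space M. 1 \<le> N k \<omega>" using sample_size_ge_1 by blast
  note iid = prob_space_axioms data.prob_space_axioms history_subalgebra[of k] sample_iid[of k]
  note g[measurable] = measurable_loss_grad_iterate[of k]
  note x[measurable] = iterate_in_history[of k] and H[measurable] = matrix_in_history[of k]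
  have [measurable]: "F \<in> borel_measurable borel" "grad F \<in> borel_measurable borel"
    using C2 by (auto intro!: borel_measurable_continuous_onI differentiable_imp_continuous_on
        simp: twice_continuously_differentiable_def differentiable_on_def)
  have spG: "space (G k) = space M" using history_subalgebra[of k] by (simp add: subalgebra_def)
  define p where "p \<omega> = H k \<omega> *v grad F (x k \<omega>)" for \<omega>
  define q where "q \<omega> \<zeta> = H k \<omega> *v loss_grad f \<zeta> (x k \<omega>)" for \<omega> \<zeta>
  have [measurable]: "(\<lambda>w. p (fst w)) \<in> borel_measurable (G k \<Otimes>\<^sub>M P)"
    unfolding p_def by measurable
  have [measurable]: "(\<lambda>w. q (fst w) (snd w)) \<in> borel_measurable (G k \<Otimes>\<^sub>M P)"
    unfolding q_def by measurable
  have "(\<lambda>w. ennreal ((p (fst w) \<bullet> q (fst w) (snd w) - (norm (p (fst w)))\<^sup>2)\<^sup>2)) \<in> borel_measurable (G k \<Otimes>\<^sub>M P)"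
    by measurable
  note ip = nn_cond_exp_cond_iid_sample[OF iid N_pos this, unfolded fst_conv snd_conv]
  have "(\<lambda>w. ennreal ((norm (q (fst w) (snd w) -
      ((q (fst w) (snd w) \<bullet> p (fst w)) / (norm (p (fst w)))\<^sup>2) *\<^sub>R p (fst w)))\<^sup>2)) \<in> borel_measurable (G k \<Otimes>\<^sub>M P)"
    by measurable
  note orth = nn_cond_exp_cond_iid_sample[OF iid N_pos this, unfolded fst_conv snd_conv]
  define \<phi> where "\<phi> m w = ennreal (F (x k (fst w) - a *\<^sub>R (H k (fst w) *v
      ((1 / real m) *\<^sub>R (\<Sum>i<m. loss_grad f (snd w i) (x k (fst w)))))) - Fm)"
    for m and w :: "'w \<times> (nat \<Rightarrow> 'z \<times> 'y)"
  have \<phi>: "\<phi> m \<in> borel_measurable (G k \<Otimes>\<^sub>M PiM {..<m} (\<lambda>_. P))" for m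
  proof -
    have "(\<lambda>w. loss_grad f (snd w i) (x k (fst w))) \<in> borel_measurable (G k \<Otimes>\<^sub>M PiM {..<m} (\<lambda>_. P))"
      if i: "i < m" for i
    proof -
      have "(\<lambda>w. (fst w, snd w i)) \<in> measurable (G k \<Otimes>\<^sub>M PiM {..<m} (\<lambda>_. P)) (G k \<Otimes>\<^sub>M P)"
        using i by (intro measurable_Pair measurable_fst measurable_compose[OF measurable_snd]
            measurable_component_singleton) simp
      from measurable_compose[OF this g] show ?thesis by simp
    qed
    then have [measurable]: "(\<lambda>w. \<Sum>i<m. loss_grad f (snd w i) (x k (fst w))) \<in> borel_measurable (G k \<Otimes>\<^sub>M PiM {..<m} (\<lambda>_. P))"
      by (intro borel_measurable_sum) simp
    show ?thesis unfolding \<phi>_def[abs_def] by measurable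
  qed
  have "(\<integral>\<^sup>+\<omega>. ennreal (F (x (Suc k) \<omega>) - Fm) \<partial>M) = (\<integral>\<^sup>+\<omega>. \<phi> (N k \<omega>) (\<omega>, \<lambda>i\<in>{..<N k \<omega>}. \<xi> k i \<omega>) \<partial>M)"
    by (intro nn_integral_cong) (simp add: \<phi>_def step a(1) batch_grad_def)
  also have "\<dots> = (\<integral>\<^sup>+\<omega>. \<integral>\<^sup>+s. \<phi> (N k \<omega>) (\<omega>, s) \<partial>PiM {..<N k \<omega>} (\<lambda>_. P) \<partial>M)"
    by (rule nn_integral_cond_iid_sample(2)[OF iid \<phi>])
  also have "\<dots> + (\<integral>\<^sup>+\<omega>. ennreal (a * \<Lambda>1 / 2 * (norm (grad F (x k \<omega>)))\<^sup>2) \<partial>M) =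
      (\<integral>\<^sup>+\<omega>. (\<integral>\<^sup>+s. \<phi> (N k \<omega>) (\<omega>, s) \<partial>PiM {..<N k \<omega>} (\<lambda>_. P)) + ennreal (a * \<Lambda>1 / 2 * (norm (grad F (x k \<omega>)))\<^sup>2) \<partial>M)"
  proof (rule nn_integral_add[symmetric])
    show "(\<lambda>\<omega>. ennreal (a * \<Lambda>1 / 2 * (norm (grad F (x k \<omega>)))\<^sup>2)) \<in> borel_measurable M"
      by (rule measurable_from_subalg[OF history_subalgebra[of k]]) measurable
  qed (rule nn_integral_cond_iid_sample(1)[OF iid \<phi>])
  also have "\<dots> \<le> (\<integral>\<^sup>+\<omega>. ennreal (F (x k \<omega>) - Fm) \<partial>M)"
  proof (rule nn_integral_mono_AE)
    from data_point_moments[of k] ip orth inner_product_test[unfolded inner_product_qn_test_def]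
      orthogonality[unfolded orthogonality_condition_def] eigenvalue_bounds AE_space
    show "AE \<omega> in M. (\<integral>\<^sup>+s. \<phi> (N k \<omega>) (\<omega>, s) \<partial>PiM {..<N k \<omega>} (\<lambda>_. P))
        + ennreal (a * \<Lambda>1 / 2 * (norm (grad F (x k \<omega>)))\<^sup>2) \<le> ennreal (F (x k \<omega>) - Fm)"
    proof eventually_elim
      case (elim \<omega>)
      have g\<omega>: "(\<lambda>\<zeta>. loss_grad f \<zeta> (x k \<omega>)) \<in> borel_measurable P"
        using measurable_compose[OF measurable_Pair1' g, of \<omega>] elim(7) spG by simp
      show ?case
        unfolding \<phi>_def fst_conv snd_conv
      proof (rule expected_descent[OF data.prob_space_axioms C2 L hessian_le lower g\<omega>])
        show "(\<integral>\<^sup>+\<zeta>. ennreal (((H k \<omega> *v grad F (x k \<omega>)) \<bullet> (H k \<omega> *v loss_grad f \<zeta> (x k \<omega>)) -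
            (norm (H k \<omega> *v grad F (x k \<omega>)))\<^sup>2)\<^sup>2) \<partial>P) / of_nat (N k \<omega>)
            \<le> ennreal (\<theta>\<^sup>2 * norm (H k \<omega> *v grad F (x k \<omega>)) ^ 4)"
          using elim(2,4) by (simp add: p_def q_def)
        show "(\<integral>\<^sup>+\<zeta>. ennreal ((norm (H k \<omega> *v loss_grad f \<zeta> (x k \<omega>) -
            ((H k \<omega> *v loss_grad f \<zeta> (x k \<omega>)) \<bullet> (H k \<omega> *v grad F (x k \<omega>)) /
              (norm (H k \<omega> *v grad F (x k \<omega>)))\<^sup>2) *\<^sub>R (H k \<omega> *v grad F (x k \<omega>))))\<^sup>2) \<partial>P) / of_nat (N k \<omega>)
            \<le> ennreal (\<nu>\<^sup>2 * (norm (H k \<omega> *v grad F (x k \<omega>)))\<^sup>2)"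
          using elim(3,5) by (simp add: p_def q_def)
      qed (use elim \<Lambda> a matrix_pos_def[of \<omega> k] sample_size_ge_1[of \<omega> k] F_eq in auto)
    qed
  qed
  finally show ?thesis .
qed

end

section \<open>Convergence\<close>

theorem theorem3p2:
  fixes M :: "'w measure" and P :: "('z \<times> 'y) measure" and G :: "nat \<Rightarrow> 'w measure"
    and f :: "real ^ 'n \<Rightarrow> 'z \<times> 'y \<Rightarrow> real" and F :: "real ^ 'n \<Rightarrow> real"
    and \<xi> :: "nat \<Rightarrow> nat \<Rightarrow> 'w \<Rightarrow> 'z \<times> 'y" and N :: "nat \<Rightarrow> 'w \<Rightarrow> nat"
    and H :: "nat \<Rightarrow> 'w \<Rightarrow> real ^ 'n ^ 'n" and \<alpha> :: "nat \<Rightarrow> real"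
    and x0 :: "real ^ 'n" and x :: "nat \<Rightarrow> 'w \<Rightarrow> real ^ 'n"
    and L \<theta> \<nu> \<Lambda>1 \<Lambda>2 a :: real
  assumes F_eq: "F = expected_loss P f"
    and C2: "twice_continuously_differentiable F"
    and bounded_below: "bdd_below (range F)"
    and L_pos: "0 < L"
    and hessian_le: "\<And>v. hessian F v \<preceq>\<^sub>L L *\<^sub>R mat 1"
    and \<theta>_pos: "0 < \<theta>" and \<nu>_pos: "0 < \<nu>"
    and \<Lambda>1_pos: "0 < \<Lambda>1" and \<Lambda>1_le_\<Lambda>2: "\<Lambda>1 \<le> \<Lambda>2"
    and iteration: "stochastic_quasi_newton M P G f \<xi> N H \<alpha> x0 x"
    and inner_product_test: "\<And>k. inner_product_qn_test M (G k) \<theta> (N k)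
          (\<lambda>\<omega>. H k \<omega> *v grad F (x k \<omega>))
          (\<lambda>\<omega>. H k \<omega> *v loss_grad f (\<xi> k 0 \<omega>) (x k \<omega>))"
    and orthogonality: "\<And>k. orthogonality_condition M (G k) \<nu> (N k)
          (\<lambda>\<omega>. H k \<omega> *v grad F (x k \<omega>))
          (\<lambda>\<omega>. H k \<omega> *v loss_grad f (\<xi> k 0 \<omega>) (x k \<omega>))"
    and eigenvalue_bounds: "\<And>k. AE \<omega> in M.
          \<Lambda>1 *\<^sub>R mat 1 \<preceq>\<^sub>L H k \<omega> \<and> H k \<omega> \<preceq>\<^sub>L \<Lambda>2 *\<^sub>R mat 1"
    and constant_step: "\<And>k. \<alpha> k = a"
    and a_pos: "0 < a"
    and a_le: "a \<le> 1 / ((1 + \<theta>\<^sup>2 + \<nu>\<^sup>2) * L * \<Lambda>2)"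
  shows "(\<forall>k. integrable M (\<lambda>\<omega>. (norm (grad F (x k \<omega>)))\<^sup>2)) \<and>
    (\<lambda>k. \<integral>\<omega>. (norm (grad F (x k \<omega>)))\<^sup>2 \<partial>M) \<longlonglongrightarrow> 0 \<and>
    (\<forall>T::nat. \<forall>F_min. 0 < T \<longrightarrow> (\<forall>v. F_min \<le> F v) \<longrightarrow>
       (MIN k\<in>{0..T - 1}. \<integral>\<omega>. (norm (grad F (x k \<omega>)))\<^sup>2 \<partial>M)
         \<le> 2 / (a * real T * \<Lambda>1) * (F x0 - F_min))"
proof -
  interpret stochastic_quasi_newton M P G f \<xi> N H \<alpha> x0 x by fact
  define c where "c = a * \<Lambda>1 / 2"
  have c: "0 < c" using a_pos \<Lambda>1_pos by (simp add: c_def)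
  define E where "E k = (\<integral>\<^sup>+\<omega>. ennreal (c * (norm (grad F (x k \<omega>)))\<^sup>2) \<partial>M)" for k
  define e where "e k = (\<integral>\<omega>. (norm (grad F (x k \<omega>)))\<^sup>2 \<partial>M)" for k
  have grad_sq: "(\<lambda>\<omega>. (norm (grad F (x k \<omega>)))\<^sup>2) \<in> borel_measurable M" for k
  proof -
    have [measurable]: "grad F \<in> borel_measurable borel"
      using C2 by (auto intro!: borel_measurable_continuous_onI differentiable_imp_continuous_on
          simp: twice_continuously_differentiable_def differentiable_on_def)
    have [measurable]: "x k \<in> borel_measurable M"
      by (rule measurable_from_subalg[OF history_subalgebra iterate_in_history])
    show ?thesis by measurable
  qed
  have telescope: "(\<Sum>k<T. E k) + (\<integral>\<^sup>+\<omega>. ennreal (F (x T \<omega>) - Fm) \<partial>M) \<le> ennreal (F x0 - Fm)"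
    if lower: "\<And>v. Fm \<le> F v" for Fm and T
  proof (induction T)
    case 0
    have "(\<integral>\<^sup>+\<omega>. ennreal (F (x 0 \<omega>) - Fm) \<partial>M) = (\<integral>\<^sup>+\<omega>. ennreal (F x0 - Fm) \<partial>M)"
      by (intro nn_integral_cong) (simp add: initial)
    then show ?case by (simp add: emeasure_space_1)
  next
    case (Suc T)
    have "(\<integral>\<^sup>+\<omega>. ennreal (F (x (Suc T) \<omega>) - Fm) \<partial>M) + E T \<le> (\<integral>\<^sup>+\<omega>. ennreal (F (x T \<omega>) - Fm) \<partial>M)"
      unfolding E_def c_def
      by (rule expected_objective_decrease[OF F_eq C2 L_pos hessian_le lower \<Lambda>1_pos \<Lambda>1_le_\<Lambda>2
            inner_product_test orthogonality eigenvalue_bounds constant_step a_pos a_le])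
    then have "(\<Sum>k<T. E k) + ((\<integral>\<^sup>+\<omega>. ennreal (F (x (Suc T) \<omega>) - Fm) \<partial>M) + E T)
        \<le> (\<Sum>k<T. E k) + (\<integral>\<^sup>+\<omega>. ennreal (F (x T \<omega>) - Fm) \<partial>M)"
      by (rule add_left_mono)
    also have "\<dots> \<le> ennreal (F x0 - Fm)" by (rule Suc.IH)
    finally show ?case by (simp add: ac_simps)
  qed
  have sum_E: "(\<Sum>k<T. E k) \<le> ennreal (F x0 - Fm)" if "\<And>v. Fm \<le> F v" for Fm T
    using telescope[OF that, of T] by (rule order_trans[rotated]) simp
  obtain F0 where F0: "F0 \<le> F v" for v
    using bounded_below by (auto simp: bdd_below_def)
  have int: "integrable M (\<lambda>\<omega>. (norm (grad F (x k \<omega>)))\<^sup>2)" for k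
  proof -
    have "E k \<le> (\<Sum>j<Suc k. E j)" by simp
    also have "\<dots> < \<infinity>" using sum_E[OF F0, of "Suc k"] by (rule le_less_trans) simp
    finally have "integrable M (\<lambda>\<omega>. c * (norm (grad F (x k \<omega>)))\<^sup>2)"
      unfolding E_def using grad_sq c by (intro integrableI_nonneg) auto
    then show ?thesis using c by simp
  qed
  have e_nonneg: "0 \<le> e k" for k
    unfolding e_def by (rule Bochner_Integration.integral_nonneg) simp
  have E_e: "E k = ennreal (c * e k)" for k
    unfolding E_def e_def using int c by (subst nn_integral_eq_integral) auto
  have sum_e: "c * (\<Sum>k<T. e k) \<le> F x0 - Fm" if "\<And>v. Fm \<le> F v" for Fm T
  proof -
    have "ennreal (c * (\<Sum>k<T. e k)) \<le> ennreal (F x0 - Fm)"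
      using sum_E[OF that, of T] c e_nonneg by (simp add: E_e sum_distrib_left sum_ennreal)
    then show ?thesis using that[of x0] by (simp add: ennreal_le_iff)
  qed
  have "e \<longlonglongrightarrow> 0"
  proof (rule summable_LIMSEQ_zero, rule summableI_nonneg_bounded)
    show "(\<Sum>k<T. e k) \<le> (F x0 - F0) / c" for T
      using sum_e[OF F0, of T] c by (simp add: pos_le_divide_eq mult.commute)
  qed (rule e_nonneg)
  moreover have "(MIN k\<in>{0..T - 1}. e k) \<le> 2 / (a * real T * \<Lambda>1) * (F x0 - F_min)"
    if T: "0 < T" and lower: "\<forall>v. F_min \<le> F v" for T :: nat and F_min
  proof -
    have range: "{0..T - 1} = {..<T}" using T by auto
    have "real (card {..<T}) * (MIN k\<in>{..<T}. e k) \<le> (\<Sum>k<T. e k)"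
      by (rule sum_bounded_below) simp
    then have "c * (real T * (MIN k\<in>{..<T}. e k)) \<le> c * (\<Sum>k<T. e k)"
      using c by (intro mult_left_mono) auto
    also have "\<dots> \<le> F x0 - F_min" using lower by (intro sum_e) auto
    finally show ?thesis
      unfolding range using T a_pos \<Lambda>1_pos by (simp add: c_def field_simps)
  qed
  ultimately show ?thesis
    using int by (auto simp: e_def[abs_def])
qed

end
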